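(* Suppose $r=0$, $\gamma_l=\gamma_h=\gamma>0$, and the probability of recall is interior, $0<q<1$. Let $(\mu_1^A,\mu_2^A,c^A)$ be the steady-state beliefs and cutoff of Society A, and let $(\mu_1^B,\mu_2^B,(\sigma_1^B)^2,(\sigma_2^B)^2,c^B)$ be the steady-state beliefs and cutoff of Society B. Then $\mu_2^B>\mu_2^A$ and $c^B>c^A$. Also, $\sigma_2^B>\sigma_2^*(c^A)$.
   Context: Fix $\mu_1^\bullet,\mu_2^\bullet\in\mathbb R$, $(\sigma^\bullet)^2>0$, $\kappa\in\mathbb R$. Stage game: the agent observes $X_1=x_1$ and either stops, receiving $u_1(x_1)=x_1$, or continues, in which case $X_2=x_2$ is drawn and she receives $u_2(x_1,x_2)=q\max(x_1,x_2)+(1-q)x_2-\kappa$. $\Psi(\mu_1,\mu_2,\sigma_1^2,\sigma_2^2;\gamma)$ is the joint law with $X_1\sim\mathcal N(\mu_1,\sigma_1^2)$ and $X_2\mid(X_1=x_1)\sim\mathcal N(\mu_2-\gamma(x_1-\mu_1),\sigma_2^2)$. The true law is $\Psi(\mu_1^\bullet,\mu_2^\bullet,(\sigma^\bullet)^2,(\sigma^\bullet)^2;0)$. For $c\in\mathbb R$, $\mathcal H(\Psi;c)$ is the law of the history when $(X_1,X_2)\sim\Psi$ and $X_2$ is censored (unobserved) whenever $X_1>c$; $\mathcal H^\bullet(c)$ is this law under the true law. Both societies dogmatically believe in the reversal parameter $\gamma$. Society A (known variances): a steady state is $(\mu_1^A,\mu_2^A,c^A)\in\mathbb R^3$ such that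 the strategy "stop iff $X_1\ge c^A$" is optimal (maximizes expected payoff among all measurable stopping strategies) under $\Psi(\mu_1^A,\mu_2^A,(\sigma^\bullet)^2,(\sigma^\bullet)^2;\gamma)$, and $(\mu_1^A,\mu_2^A)$ minimizes $D_{KL}(\mathcal H^\bullet(c^A)\,\|\,\mathcal H(\Psi(\mu_1,\mu_2,(\sigma^\bullet)^2,(\sigma^\bullet)^2;\gamma);c^A))$ over $(\mu_1,\mu_2)\in\mathbb R^2$. (It is unique.) Society B (unknown variances): a steady state is $(\mu_1^B,\mu_2^B,(\sigma_1^B)^2,(\sigma_2^B)^2,c^B)$ such that "stop iff $X_1\ge c^B$" is optimal under $\Psi(\mu_1^B,\mu_2^B,(\sigma_1^B)^2,(\sigma_2^B)^2;\gamma)$, and $(\mu_1^B,\mu_2^B,(\sigma_1^B)^2,(\sigma_2^B)^2)$ minimizes $D_{KL}(\mathcal H^\bullet(c^B)\,\|\,\mathcal H(\Psi(\mu_1,\mu_2,\sigma_1^2,\sigma_2^2;\gamma);c^B))$ over $\mu_1,\mu_2\in\mathbb R$, $\sigma_1^2,\sigma_2^2\ge0$ (the divergence being $+\infty$ at zero variances). For $c\in\mathbb R$, $\sigma_2^*(c)$ denotes the square root of the $\sigma_2^2$-component of the minimizer of $D_{KL}(\mathcal H^\bullet(c)\,\|\,\mathcal H(\Psi(\mu_1,\mu_2,\sigma_1^2,\sigma_2^2;\gamma);c))$ over $\mu_1,\mu_2\in\mathbb R$, $\sigma_1^2,\sigma_2^2\ge0$. The statement is to be read as: for any steady state of Society B.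 *)

theory Defs
  imports "HOL-Probability.Probability"
begin

text \<open>Normal law with mean \<open>m\<close> and variance \<open>v\<close> (not standard deviation). The degenerate
  case needs separate treatment, because \<^const>\<open>normal_density\<close> vanishes identically at
  standard deviation 0.\<close>

definition normal_law :: "real \<Rightarrow> real \<Rightarrow> real measure" where
  "normal_law m v =
     (if v = 0 then return borel m
      else density lborel (\<lambda>x. ennreal (normal_density m (sqrt v) x)))"

definition Psi :: "real \<Rightarrow> real \<Rightarrow> real \<Rightarrow> real \<Rightarrow> real \<Rightarrow> (real \<times> real) measure" where
  "Psi m1 m2 v1 v2 g =
     normal_law m1 v1 \<bind> (\<lambda>x1.
       normal_law (m2 - g * (x1 - m1)) v2 \<bind> (\<lambda>x2.
         return (borel \<Otimes>\<^sub>M borel) (x1, x2)))"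

definition u1 :: "real \<Rightarrow> real" where
  "u1 x1 = x1"

definition u2 :: "real \<Rightarrow> real \<Rightarrow> real \<Rightarrow> real \<Rightarrow> real" where
  "u2 q \<kappa> x1 x2 = q * max x1 x2 + (1 - q) * x2 - \<kappa>"

text \<open>A stopping strategy is represented by its stopping region, i.e. the set of first draws
  after which the agent stops.\<close>

definition expected_payoff ::
    "real \<Rightarrow> real \<Rightarrow> (real \<times> real) measure \<Rightarrow> real set \<Rightarrow> real" where
  "expected_payoff q \<kappa> P S =
     (\<integral>(x1, x2). (if x1 \<in> S then u1 x1 else u2 q \<kappa> x1 x2) \<partial>P)"

definition optimal_strategy ::
    "real \<Rightarrow> real \<Rightarrow> (real \<times> real) measure \<Rightarrow> real set \<Rightarrow> bool" where
  "optimal_strategy q \<kappa> P = is_arg_max (expected_payoff q \<kappa> P) (\<lambda>S. S \<in> sets borel)"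

text \<open>\<^const>\<open>None\<close> stands for an unobserved second draw. The sigma-algebra on
  \<^typ>\<open>real option\<close> is that of the disjoint union of the Borel line and a point.\<close>

definition option_borel :: "real option measure" where
  "option_borel = sigma UNIV {A. Some -` A \<in> sets borel}"

definition censor :: "real \<Rightarrow> real \<times> real \<Rightarrow> real \<times> real option" where
  "censor c = (\<lambda>(x1, x2). (x1, if x1 > c then None else Some x2))"

definition history_law :: "(real \<times> real) measure \<Rightarrow> real \<Rightarrow> (real \<times> real option) measure" where
  "history_law P c = distr P (borel \<Otimes>\<^sub>M option_borel) (censor c)"

text \<open>\<open>kl_div P Q\<close> is the divergence of \<open>P\<close> from \<open>Q\<close>, with the reference law second, whereas
  \<^const>\<open>KL_divergence\<close> takes the reference measure first. \<^const>\<open>KL_divergence\<close> is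
  real-valued and only meaningful when \<open>P\<close> has a density with respect to \<open>Q\<close> and the log-density
  is \<open>P\<close>-integrable. Otherwise the divergence of two probability laws is infinite: the negative
  part of the log-density always has finite \<open>P\<close>-integral, so non-integrability forces the value
  infinity.\<close>

definition kl_div :: "'a measure \<Rightarrow> 'a measure \<Rightarrow> ereal" where
  "kl_div P Q =
     (if absolutely_continuous Q P \<and> integrable P (entropy_density (exp 1) Q P)
      then ereal (KL_divergence (exp 1) Q P) else \<infinity>)"

text \<open>\<open>mt1\<close>, \<open>mt2\<close> and \<open>vt\<close> are the true means and the true common variance; \<open>g\<close> is the
  reversal parameter in which the agents believe. The true reversal parameter is 0.\<close>

definition true_history :: "real \<Rightarrow> real \<Rightarrow> real \<Rightarrow> real \<Rightarrow> (real \<times> real option) measure" where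
  "true_history mt1 mt2 vt c = history_law (Psi mt1 mt2 vt vt 0) c"

definition min_known_var ::
    "real \<Rightarrow> real \<Rightarrow> real \<Rightarrow> real \<Rightarrow> real \<Rightarrow> real \<times> real \<Rightarrow> bool" where
  "min_known_var mt1 mt2 vt g c =
     is_arg_min
       (\<lambda>(m1, m2). kl_div (true_history mt1 mt2 vt c) (history_law (Psi m1 m2 vt vt g) c))
       (\<lambda>_. True)"

definition min_unknown_var ::
    "real \<Rightarrow> real \<Rightarrow> real \<Rightarrow> real \<Rightarrow> real \<Rightarrow> real \<times> real \<times> real \<times> real \<Rightarrow> bool" where
  "min_unknown_var mt1 mt2 vt g c =
     is_arg_min
       (\<lambda>(m1, m2, v1, v2).
          kl_div (true_history mt1 mt2 vt c) (history_law (Psi m1 m2 v1 v2 g) c))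
       (\<lambda>(m1, m2, v1, v2). 0 \<le> v1 \<and> 0 \<le> v2)"

definition steady_state_A ::
    "real \<Rightarrow> real \<Rightarrow> real \<Rightarrow> real \<Rightarrow> real \<Rightarrow> real \<Rightarrow> real \<Rightarrow> real \<Rightarrow> real \<Rightarrow> bool" where
  "steady_state_A mt1 mt2 vt \<kappa> q g m1 m2 c \<longleftrightarrow>
     optimal_strategy q \<kappa> (Psi m1 m2 vt vt g) {c..} \<and>
     min_known_var mt1 mt2 vt g c (m1, m2)"

definition steady_state_B ::
    "real \<Rightarrow> real \<Rightarrow> real \<Rightarrow> real \<Rightarrow> real \<Rightarrow> real \<Rightarrow>
     real \<Rightarrow> real \<Rightarrow> real \<Rightarrow> real \<Rightarrow> real \<Rightarrow> bool" where
  "steady_state_B mt1 mt2 vt \<kappa> q g m1 m2 v1 v2 c \<longleftrightarrow>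
     optimal_strategy q \<kappa> (Psi m1 m2 v1 v2 g) {c..} \<and>
     min_unknown_var mt1 mt2 vt g c (m1, m2, v1, v2)"

definition sigma2_star :: "real \<Rightarrow> real \<Rightarrow> real \<Rightarrow> real \<Rightarrow> real \<Rightarrow> real" where
  "sigma2_star mt1 mt2 vt g c =
     (case (THE p. min_unknown_var mt1 mt2 vt g c p) of (m1, m2, v1, v2) \<Rightarrow> sqrt v2)"

lemma space_option_borel [simp]: "space option_borel = UNIV"
  by (simp add: option_borel_def)

lemma sets_option_borel: "sets option_borel = {A. Some -` A \<in> sets borel}"
proof -
  have "sigma_algebra UNIV {A. (Some :: real \<Rightarrow> _) -` A \<in> sets borel}"
    by (auto simp: sigma_algebra_iff2 vimage_Union vimage_Compl borel_comp
        Compl_eq_Diff_UNIV[symmetric] intro!: sets.countable_UN)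
  then show ?thesis
    unfolding option_borel_def by (simp add: sigma_algebra.sigma_sets_eq)
qed

lemma Some_measurable_option_borel [measurable]: "Some \<in> borel \<rightarrow>\<^sub>M option_borel"
  by (rule measurableI) (auto simp: sets_option_borel)

lemma censor_measurable [measurable]:
  "censor c \<in> borel \<Otimes>\<^sub>M borel \<rightarrow>\<^sub>M borel \<Otimes>\<^sub>M option_borel"
  unfolding censor_def by measurable

lemma normal_law_std: "normal_law 0 1 = density lborel (\<lambda>x. ennreal (std_normal_density x))"
  by (simp add: normal_law_def)

lemma normal_law_std_space: "normal_law 0 1 \<in> space (prob_algebra borel)"
  by (simp add: space_prob_algebra normal_law_std prob_space_normal_density)

lemma normal_law_eq_distr:
  assumes "0 \<le> v"
  shows "normal_law m v = distr (normal_law 0 1) borel (\<lambda>z. m + sqrt v * z)"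
proof (cases "v = 0")
  case True
  interpret N: prob_space "normal_law 0 1"
    using normal_law_std_space by (simp add: space_prob_algebra)
  show ?thesis
    using True by (simp add: normal_law_def[of m])
next
  case False
  let ?N = "density lborel (\<lambda>x. ennreal (std_normal_density x))"
  interpret N: prob_space ?N
    by (rule prob_space_normal_density) simp
  have "distributed ?N lborel (\<lambda>x. x) std_normal_density"
    by (auto simp: distributed_def intro: distr_id2)
  from N.normal_density_affine[OF this, of "sqrt v" m] assms False
  have "distributed ?N lborel (\<lambda>x. m + sqrt v * x) (normal_density m (sqrt v))"
    by simp
  then have "distr ?N lborel (\<lambda>x. m + sqrt v * x) = density lborel (normal_density m (sqrt v))"
    by (simp add: distributed_def)
  moreover have "distr ?N lborel (\<lambda>x. m + sqrt v * x) = distr ?N borel (\<lambda>x. m + sqrt v * x)"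
    by (rule distr_cong) auto
  ultimately show ?thesis
    using False unfolding normal_law_std by (simp add: normal_law_def)
qed

lemma normal_law_measurable:
  assumes "0 \<le> v" and [measurable]: "f \<in> borel_measurable M"
  shows "(\<lambda>x. normal_law (f x) v) \<in> M \<rightarrow>\<^sub>M prob_algebra borel"
proof -
  have [measurable]: "(\<lambda>_. normal_law 0 1) \<in> M \<rightarrow>\<^sub>M prob_algebra borel"
    by (rule measurable_const) (rule normal_law_std_space)
  show ?thesis
    unfolding normal_law_eq_distr[OF assms(1)] by measurable
qed

lemma Psi_in_prob_algebra:
  assumes "0 \<le> v1" "0 \<le> v2"
  shows "Psi m1 m2 v1 v2 g \<in> space (prob_algebra (borel \<Otimes>\<^sub>M borel))"
proof -
  note [measurable] = normal_law_measurable[OF assms(1)] normal_law_measurable[OF assms(2)]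
  have "(\<lambda>_::unit. Psi m1 m2 v1 v2 g)
      \<in> count_space UNIV \<rightarrow>\<^sub>M prob_algebra (borel \<Otimes>\<^sub>M borel)"
    unfolding Psi_def by measurable
  then show ?thesis
    by (auto dest: measurable_space)
qed

lemma
  assumes "0 \<le> v1" "0 \<le> v2"
  shows prob_space_Psi: "prob_space (Psi m1 m2 v1 v2 g)"
    and sets_Psi: "sets (Psi m1 m2 v1 v2 g) = sets (borel \<Otimes>\<^sub>M borel)"
  using Psi_in_prob_algebra[OF assms] by (simp_all add: space_prob_algebra)

end

theory Submission
  imports Defs "HOL-Real_Asymp.Real_Asymp"
begin

text \<open>With censoring cutoff \<open>c\<close>, the divergence is, up to constants and with
  \<open>h v A = ln v + A / v\<close>, half of
  \<open>h v1 (vt + (mt1 - m1)\<^sup>2) + P (X\<^sub>1 \<le> c) * h v2 (vt + B\<^sup>2 + g\<^sup>2 * Var (X\<^sub>1 | X\<^sub>1 \<le> c))\<close>, where \<open>B\<close> is the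
  bias of the predicted second draw at \<open>X\<^sub>1 = E (X\<^sub>1 | X\<^sub>1 \<le> c)\<close>. So both societies infer
  \<open>m1 = mt1\<close> and the same \<open>m2\<close> as a function of \<open>c\<close>, which is increasing in \<open>c\<close>, while Society B
  also infers \<open>v2 = vt + g\<^sup>2 * Var (X\<^sub>1 | X\<^sub>1 \<le> c) > vt\<close>. At an optimal cutoff the agent is
  indifferent; the gain from stopping increases in the difference \<open>d c\<close> between \<open>c\<close> and the
  predicted second draw after \<open>X\<^sub>1 = c\<close>, and, because recall makes the payoff of continuing convex
  in the second draw, it decreases in the inferred variance. Since \<open>d c\<close> increases in \<open>c\<close>, a larger
  inferred variance forces a larger cutoff. All the monotonicities reduce to log-concavity of the
  iterated integrals of the normal density.\<close>

section \<open>Truncated normal moments\<close>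

abbreviation std_normal :: "real measure" where
  "std_normal \<equiv> normal_law 0 1"

abbreviation \<phi> :: "real \<Rightarrow> real" where
  "\<phi> \<equiv> std_normal_density"

definition \<Phi> :: "real \<Rightarrow> real" where
  "\<Phi> z = cdf std_normal z"

lemma real_distribution_std_normal: "real_distribution std_normal"
  using normal_law_std_space
  by (auto simp: space_prob_algebra real_distribution_def real_distribution_axioms_def)

interpretation std_normal: real_distribution std_normal
  by (rule real_distribution_std_normal)

lemma phi_pos [simp]: "0 < \<phi> x"
  by (simp add: normal_density_pos)

lemma phi_has_derivative [derivative_intros]: "(\<phi> has_real_derivative - (x * \<phi> x)) (at x)"
proof -
  have "((\<lambda>x. K * exp (- x\<^sup>2 / 2)) has_real_derivative - (x * (K * exp (- x\<^sup>2 / 2)))) (at x)"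
    for K :: real
    by (auto intro!: derivative_eq_intros)
  then show ?thesis
    unfolding std_normal_density_def .
qed

lemma continuous_on_phi: "continuous_on S \<phi>"
  using phi_has_derivative by (meson DERIV_isCont continuous_at_imp_continuous_on)

lemma Phi_eq_integral: "\<Phi> z = (\<integral>x. indicator {..z} x * \<phi> x \<partial>lborel)"
proof -
  have "\<Phi> z = (\<integral>x. indicator {..z} x \<partial>std_normal)"
    by (simp add: \<Phi>_def cdf_def)
  also have "\<dots> = (\<integral>x. \<phi> x *\<^sub>R indicator {..z} x \<partial>lborel)"
    unfolding normal_law_std by (rule integral_density) auto
  finally show ?thesis
    by (simp add: mult.commute)
qed

text \<open>Near x the distribution function differs by the constant \<open>\<Phi> (x - 1)\<close>
  from an integral of \<open>\<phi>\<close> with finite endpoints, to which the fundamental theorem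
  of calculus applies.\<close>

lemma Phi_has_derivative [derivative_intros]: "(\<Phi> has_real_derivative \<phi> x) (at x)"
proof -
  let ?a = "x - 1" and ?b = "x + 1"
  have "((\<lambda>u. LBINT y=?a..u. \<phi> y) has_vector_derivative \<phi> x) (at x within {?a..?b})"
    by (rule interval_integral_FTC2) (auto intro: continuous_on_phi)
  then have d: "((\<lambda>u. LBINT y=?a..u. \<phi> y) has_real_derivative \<phi> x) (at x)"
    by (simp add: at_within_Icc_at has_real_derivative_iff_has_vector_derivative)
  have "\<Phi> u = \<Phi> ?a + (LBINT y=?a..u. \<phi> y)" if "u \<in> {?a<..<?b}" for u
  proof -
    have "\<Phi> u - \<Phi> ?a = (\<integral>y. indicator {..u} y * \<phi> y - indicator {..?a} y * \<phi> y \<partial>lborel)"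
      unfolding Phi_eq_integral
      by (rule Bochner_Integration.integral_diff[symmetric])
        (auto intro!: integrable_real_mult_indicator simp: mult.commute[of "indicator _ _"])
    also have "\<dots> = (LBINT y:{?a<..u}. \<phi> y)"
      unfolding set_lebesgue_integral_def
      using that by (intro Bochner_Integration.integral_cong) (auto simp: indicator_def)
    also have "\<dots> = (LBINT y=?a..u. \<phi> y)"
      using that by (simp add: interval_integral_Ioc)
    finally show ?thesis by simp
  qed
  then have "eventually (\<lambda>u. \<Phi> u = \<Phi> ?a + (LBINT y=?a..u. \<phi> y)) (nhds x)"
    by (intro eventually_nhds_in_open[THEN eventually_mono, of "{?a<..<?b}"]) auto
  moreover have "((\<lambda>u. \<Phi> ?a + (LBINT y=?a..u. \<phi> y)) has_real_derivative \<phi> x) (at x)"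
    using d by (auto intro!: derivative_eq_intros)
  ultimately show ?thesis
    by (subst DERIV_cong_ev[OF refl _ refl])
qed

lemma Phi_tendsto_at_bot: "(\<Phi> \<longlongrightarrow> 0) at_bot"
  unfolding \<Phi>_def[abs_def] using std_normal.cdf_lim_at_bot by simp

text \<open>An antiderivative of the density times p that vanishes at minus infinity is the
  truncated moment. With p equal to 1, x and x^2, this reduces the moments below to guessing
  \<open>\<Phi>\<close>, \<open>- \<phi>\<close> and \<open>\<Phi> z - z * \<phi> z\<close>.\<close>

lemma truncated_std_normal_integral:
  assumes F: "\<And>x. (F has_real_derivative \<phi> x * p x) (at x)"
    and p: "continuous_on UNIV p"
    and int: "integrable lborel (\<lambda>x. \<phi> x * p x)"
    and lim: "(F \<longlongrightarrow> 0) at_bot"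
  shows "has_bochner_integral std_normal (\<lambda>x. indicator {..z} x * p x) (F z)"
proof -
  have [measurable]: "p \<in> borel_measurable borel"
    using p by (rule borel_measurable_continuous_onI)
  have int': "set_integrable lborel S (\<lambda>x. \<phi> x * p x)" if "S \<in> sets lborel" for S
    unfolding set_integrable_def using that int by (rule integrable_mult_indicator)
  have "(LBINT x=-\<infinity>..z. \<phi> x * p x) = F z - 0"
  proof (rule interval_integral_FTC_integrable)
    show "(F has_vector_derivative \<phi> x * p x) (at x)" for x
      using F by (simp add: has_real_derivative_iff_has_vector_derivative)
    show "isCont (\<lambda>x. \<phi> x * p x) x" for x
      using p continuous_on_phi[of UNIV]
      by (auto intro!: continuous_intros simp: continuous_on_eq_continuous_at)
    show "((F \<circ> real_of_ereal) \<longlongrightarrow> 0) (at_right (- \<infinity>))"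
      using lim by (simp add: ereal_tendsto_simps)
    show "((F \<circ> real_of_ereal) \<longlongrightarrow> F z) (at_left (ereal z))"
      using DERIV_isCont[OF F, of z]
      by (simp add: ereal_tendsto_simps isCont_def filterlim_at_split)
  qed (auto intro: int')
  moreover have "(LBINT x=-\<infinity>..z. \<phi> x * p x) = (LBINT x:{..<z}. \<phi> x * p x)"
    by (simp add: interval_lebesgue_integral_def)
  \<comment> \<open>The improper interval integral runs over the open ray; the closed one differs
    from it by a null set.\<close>
  moreover have "(LBINT x:{..<z}. \<phi> x * p x) = (LBINT x:{..z}. \<phi> x * p x)"
    using AE_lborel_singleton[of z]
    by (intro set_integral_cong_set) (auto simp: set_borel_measurable_def elim!: eventually_mono)
  ultimately have "F z = (LBINT x. \<phi> x *\<^sub>R (indicator {..z} x * p x))"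
    by (simp add: set_lebesgue_integral_def mult.left_commute)
  moreover have "integrable lborel (\<lambda>x. \<phi> x *\<^sub>R (indicator {..z} x * p x))"
    using int'[of "{..z}"] by (simp add: set_integrable_def mult.left_commute)
  ultimately have "has_bochner_integral lborel (\<lambda>x. \<phi> x *\<^sub>R (indicator {..z} x * p x)) (F z)"
    by (simp add: has_bochner_integral_iff)
  then show ?thesis
    unfolding normal_law_std by (intro has_bochner_integral_density) auto
qed

lemma truncated_moment_0: "has_bochner_integral std_normal (indicator {..z}) (\<Phi> z)"
  using truncated_std_normal_integral[of \<Phi> "\<lambda>_. 1" z]
  by (auto intro!: derivative_eq_intros Phi_tendsto_at_bot)

lemma truncated_moment_1:
  "has_bochner_integral std_normal (\<lambda>x. indicator {..z} x * x) (- \<phi> z)"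
proof (rule truncated_std_normal_integral)
  show "((\<lambda>x. - \<phi> x) has_real_derivative \<phi> x * x) (at x)" for x
    by (auto intro!: derivative_eq_intros)
  show "((\<lambda>x. - \<phi> x) \<longlongrightarrow> 0) at_bot"
    unfolding std_normal_density_def by real_asymp
qed (use integrable_std_normal_moment[of 1] in auto)

lemma truncated_moment_2:
  "has_bochner_integral std_normal (\<lambda>x. indicator {..z} x * x\<^sup>2) (\<Phi> z - z * \<phi> z)"
proof (rule truncated_std_normal_integral)
  show "((\<lambda>z. \<Phi> z - z * \<phi> z) has_real_derivative \<phi> x * x\<^sup>2) (at x)" for x
    by (auto intro!: derivative_eq_intros simp: power2_eq_square)
  have "((\<lambda>x. x * \<phi> x) \<longlongrightarrow> 0) at_bot"
    unfolding std_normal_density_def by real_asymp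
  then show "((\<lambda>z. \<Phi> z - z * \<phi> z) \<longlongrightarrow> 0) at_bot"
    using Phi_tendsto_at_bot tendsto_diff by fastforce
qed (use integrable_std_normal_moment[of 2] in \<open>auto intro!: continuous_intros\<close>)

lemma std_normal_moment_1: "has_bochner_integral std_normal (\<lambda>x. x) 0"
  unfolding normal_law_std using std_normal_moment_odd[of 0]
  by (intro has_bochner_integral_density) auto

lemma std_normal_moment_2: "has_bochner_integral std_normal (\<lambda>x. x\<^sup>2) 1"
  unfolding normal_law_std using std_normal_moment_even[of 1]
  by (intro has_bochner_integral_density) auto

lemma Phi_pos [simp]: "0 < \<Phi> z"
proof -
  have "\<Phi> (z - 1) < \<Phi> z"
    by (rule DERIV_pos_imp_increasing[of _ _ \<Phi>]) (use Phi_has_derivative phi_pos in \<open>auto intro!: exI\<close>)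
  moreover have "0 \<le> \<Phi> (z - 1)"
    by (simp add: \<Phi>_def std_normal.cdf_nonneg)
  ultimately show ?thesis by simp
qed

lemma Phi_neq_0 [simp]: "\<Phi> z \<noteq> 0"
  using Phi_pos[of z] by (rule less_imp_neq[symmetric])

text \<open>The first and second iterated integrals of \<^const>\<open>\<Phi>\<close> from minus infinity.\<close>

definition \<Phi>2 :: "real \<Rightarrow> real" where
  "\<Phi>2 z = z * \<Phi> z + \<phi> z"

definition \<Phi>3 :: "real \<Rightarrow> real" where
  "\<Phi>3 z = ((z\<^sup>2 + 1) * \<Phi> z + z * \<phi> z) / 2"

lemma Phi2_has_derivative [derivative_intros]: "(\<Phi>2 has_real_derivative \<Phi> x) (at x)"
  unfolding \<Phi>2_def[abs_def] by (auto intro!: derivative_eq_intros)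

lemma Phi3_has_derivative [derivative_intros]: "(\<Phi>3 has_real_derivative \<Phi>2 x) (at x)"
  unfolding \<Phi>3_def[abs_def] \<Phi>2_def
  by (auto intro!: derivative_eq_intros simp: field_simps power2_eq_square)

text \<open>Besides giving the sign of \<open>\<Phi>2\<close>, this formula prices recall:
  \<open>max 0 (z - x)\<close> is the payoff of falling back on the first draw.\<close>

lemma Phi2_integral:
  "has_bochner_integral std_normal (\<lambda>x. max 0 (z - x)) (\<Phi>2 z)"
proof -
  have "has_bochner_integral std_normal
      (\<lambda>x. z * indicator {..z} x - indicator {..z} x * x) (z * \<Phi> z - (- \<phi> z))"
    by (intro has_bochner_integral_diff has_bochner_integral_mult_right
        truncated_moment_0 truncated_moment_1)
  also have "(\<lambda>x. z * indicator {..z} x - indicator {..z} x * x) = (\<lambda>x. max 0 (z - x))"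
    by (auto simp: indicator_def)
  finally show ?thesis
    by (simp add: \<Phi>2_def)
qed

lemma Phi2_nonneg: "0 \<le> \<Phi>2 z"
proof -
  have "0 \<le> (\<integral>x. max 0 (z - x) \<partial>std_normal)"
    by (rule Bochner_Integration.integral_nonneg) simp
  then show ?thesis
    using has_bochner_integral_integral_eq[OF Phi2_integral] by simp
qed

text \<open>For nonpositive z, every x below z has a square of at least z^2, so the truncated second
  moment dominates. The bound yields \<open>\<Phi>3 z \<le> \<Phi> z\<close>, hence the limit of
  \<open>\<Phi>3\<close> at minus infinity.\<close>

lemma square_Phi_le:
  assumes "z \<le> 0" shows "z\<^sup>2 * \<Phi> z \<le> \<Phi> z - z * \<phi> z"
proof -
  have "(\<integral>x. z\<^sup>2 * indicator {..z} x \<partial>std_normal) \<le> (\<integral>x. indicator {..z} x * x\<^sup>2 \<partial>std_normal)"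
  proof (rule integral_mono)
    show "z\<^sup>2 * indicator {..z} x \<le> indicator {..z} x * x\<^sup>2" for x :: real
      using assms power_mono[of "-z" "-x" 2] by (auto simp: indicator_def)
  qed (use truncated_moment_0[of z] truncated_moment_2[of z] in
    \<open>auto simp: has_bochner_integral_iff\<close>)
  then show ?thesis
    using truncated_moment_0[of z] truncated_moment_2[of z]
    by (simp add: has_bochner_integral_iff)
qed

lemma Phi2_tendsto_at_bot: "(\<Phi>2 \<longlongrightarrow> 0) at_bot"
proof (rule tendsto_sandwich)
  show "\<forall>\<^sub>F z in at_bot. \<Phi>2 z \<le> \<phi> z"
    using eventually_le_at_bot[of 0]
    by eventually_elim (auto simp: \<Phi>2_def mult_le_0_iff less_imp_le)
  show "\<forall>\<^sub>F z in at_bot. 0 \<le> \<Phi>2 z"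
    by (simp add: Phi2_nonneg)
  show "(\<phi> \<longlongrightarrow> 0) at_bot"
    unfolding std_normal_density_def by real_asymp
qed auto

lemma Phi3_tendsto_at_bot: "(\<Phi>3 \<longlongrightarrow> 0) at_bot"
proof (rule tendsto_sandwich)
  show "\<forall>\<^sub>F z in at_bot. \<Phi>3 z \<le> \<Phi> z"
    using eventually_le_at_bot[of 0]
    by eventually_elim (use square_Phi_le in \<open>auto simp: \<Phi>3_def algebra_simps\<close>)
  show "\<forall>\<^sub>F z in at_bot. z * \<phi> z / 2 \<le> \<Phi>3 z"
    by (simp add: \<Phi>3_def less_imp_le)
  show "((\<lambda>z. z * \<phi> z / 2) \<longlongrightarrow> 0) at_bot"
    unfolding std_normal_density_def by real_asymp
qed (auto intro: Phi_tendsto_at_bot)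

text \<open>A monotone form of l'Hopital's rule at minus infinity.\<close>

lemma ratio_strict_antimono:
  fixes F G f g :: "real \<Rightarrow> real"
  assumes F: "\<And>x. (F has_real_derivative f x) (at x)"
    and G: "\<And>x. (G has_real_derivative g x) (at x)"
    and F0: "(F \<longlongrightarrow> 0) at_bot" and G0: "(G \<longlongrightarrow> 0) at_bot"
    and g: "\<And>x. 0 < g x"
    and ratio: "\<And>x y. x < y \<Longrightarrow> f y / g y < f x / g x"
  shows "f z * G z < F z * g z"
proof -
  define r where "r = f z / g z"
  \<comment> \<open>Up to z the ratio of the derivatives exceeds its value r at z, so H increases
    strictly there; the claim is that H is positive at z.\<close>
  define H where "H x = F x - r * G x" for x
  have H': "(H has_real_derivative f x - r * g x) (at x)" for x
    unfolding H_def[abs_def] using F G by (auto intro!: derivative_eq_intros)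
  have less: "H x < H y" if "x < y" "y \<le> z" for x y
  proof (rule DERIV_pos_imp_increasing_open[OF \<open>x < y\<close>])
    fix t assume "x < t" "t < y"
    then have "r < f t / g t"
      using ratio[of t z] that by (simp add: r_def)
    then have "0 < f t - r * g t"
      using g[of t] by (simp add: field_simps)
    then show "\<exists>d. (H has_real_derivative d) (at t) \<and> 0 < d"
      using H' by blast
  qed (auto intro!: DERIV_isCont[OF H'] continuous_at_imp_continuous_on)
  \<comment> \<open>The limit gives only a weak inequality; the increase from z - 1 to z makes it
    strict.\<close>
  have "(H \<longlongrightarrow> 0 - r * 0) at_bot"
    unfolding H_def[abs_def] by (intro tendsto_intros F0 G0)
  then have "0 \<le> H (z - 1)"
    by (intro tendsto_upperbound[where F = at_bot and f = H])
      (use less in \<open>auto intro!: eventually_mono[OF eventually_gt_at_bot[of "z - 1"]] less_imp_le\<close>)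
  also have "\<dots> < H z"
    by (rule less) auto
  finally show ?thesis
    using g[of z] by (simp add: H_def r_def field_simps)
qed

text \<open>The two product inequalities are the strict log-concavity of \<open>\<Phi>2\<close> and
  \<open>\<Phi>3\<close>. Log-concavity of a function makes the ratio of its derivative to itself
  decrease, and the monotone l'Hopital rule carries this over to the next iterated integral. The
  induction starts with \<open>\<Phi>\<close>.\<close>

lemma Phi_ineqs:
  shows phi_Phi2_less: "\<phi> z * \<Phi>2 z < \<Phi> z * \<Phi> z"
    and Phi_Phi3_less: "\<Phi> z * \<Phi>3 z < \<Phi>2 z * \<Phi>2 z"
    and Phi2_pos: "0 < \<Phi>2 z"
proof -
  have pos: "0 < \<Phi>2 z" for z
  proof -
    have "\<Phi>2 (z - 1) < \<Phi>2 z"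
      by (rule DERIV_pos_imp_increasing[of _ _ \<Phi>2]) (use Phi2_has_derivative in \<open>auto intro!: exI\<close>)
    then show ?thesis
      using Phi2_nonneg[of "z - 1"] by simp
  qed
  have step: "F y / G y < F x / G x"
    if "\<And>x. (F has_real_derivative f x) (at x)" "\<And>x. (G has_real_derivative F x) (at x)"
      "\<And>x. f x * G x < F x * F x" "\<And>x. 0 < G x" "x < y"
    for F G f :: "real \<Rightarrow> real" and x y
  proof (rule DERIV_neg_imp_decreasing[OF \<open>x < y\<close>])
    fix t
    have "((\<lambda>x. F x / G x) has_real_derivative (f t * G t - F t * F t) / (G t * G t)) (at t)"
      using that(1,2) that(4)[of t] by (auto intro!: derivative_eq_intros)
    moreover have "(f t * G t - F t * F t) / (G t * G t) < 0"
      using that(3,4)[of t] by (simp add: divide_neg_pos)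
    ultimately show "\<exists>d. ((\<lambda>x. F x / G x) has_real_derivative d) (at t) \<and> d < 0"
      by blast
  qed
  \<comment> \<open>Log-concavity of \<open>\<Phi>\<close> is the positivity of
    \<open>\<Phi>2 t\<close>, multiplied by \<open>\<phi> t\<close>.\<close>
  have 1: "- (t * \<phi> t) * \<Phi> t < \<phi> t * \<phi> t" for t
    using pos[of t] phi_pos[of t] mult_pos_pos[of "\<phi> t" "\<Phi>2 t"]
    by (simp add: \<Phi>2_def algebra_simps)
  have 2: "\<phi> y / \<Phi> y < \<phi> x / \<Phi> x" if "x < y" for x y
    using step[OF phi_has_derivative Phi_has_derivative 1 Phi_pos that] .
  have 3: "\<phi> t * \<Phi>2 t < \<Phi> t * \<Phi> t" for t
    by (rule ratio_strict_antimono[OF Phi_has_derivative Phi2_has_derivative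
          Phi_tendsto_at_bot Phi2_tendsto_at_bot Phi_pos 2])
  have 4: "\<Phi> y / \<Phi>2 y < \<Phi> x / \<Phi>2 x" if "x < y" for x y
    using step[OF Phi_has_derivative Phi2_has_derivative 3 pos that] .
  show "0 < \<Phi>2 z" by (rule pos)
  show "\<phi> z * \<Phi>2 z < \<Phi> z * \<Phi> z" by (rule 3)
  show "\<Phi> z * \<Phi>3 z < \<Phi>2 z * \<Phi>2 z"
    by (rule ratio_strict_antimono[OF Phi2_has_derivative Phi3_has_derivative
          Phi2_tendsto_at_bot Phi3_tendsto_at_bot pos 4])
qed

text \<open>For a standard normal \<open>Z\<close>, the mean and the variance of \<open>Z\<close> given \<open>Z \<le> z\<close> are
  \<open>- mills z\<close> and \<open>trunc_var z\<close>.\<close>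

definition mills :: "real \<Rightarrow> real" where
  "mills z = \<phi> z / \<Phi> z"

definition trunc_var :: "real \<Rightarrow> real" where
  "trunc_var z = 1 - z * mills z - (mills z)\<^sup>2"

lemma mills_has_derivative: "(mills has_real_derivative - mills z * (z + mills z)) (at z)"
proof -
  have "(mills has_real_derivative (- (z * \<phi> z) * \<Phi> z - \<phi> z * \<phi> z) / (\<Phi> z * \<Phi> z)) (at z)"
    unfolding mills_def[abs_def] using Phi_neq_0[of z]
    by (auto intro!: derivative_eq_intros)
  moreover have "(- (z * \<phi> z) * \<Phi> z - \<phi> z * \<phi> z) / (\<Phi> z * \<Phi> z) = - mills z * (z + mills z)"
    using less_imp_neq[OF Phi_pos[of z]] by (simp add: mills_def field_simps)
  ultimately show ?thesis by simp
qed

lemma mills_pos: "0 < mills z"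
  by (simp add: mills_def)

text \<open>The derivative is negative because \<open>z + mills z\<close> equals the positive
  quotient \<open>\<Phi>2 z / \<Phi> z\<close>.\<close>

lemma mills_strict_antimono: "x < y \<Longrightarrow> mills y < mills x"
proof (rule DERIV_neg_imp_decreasing[of _ _ mills])
  fix z
  have "z + mills z = \<Phi>2 z / \<Phi> z"
    using less_imp_neq[OF Phi_pos[of z]] by (simp add: mills_def \<Phi>2_def field_simps)
  then have "0 < z + mills z"
    by (simp add: Phi2_pos)
  then show "\<exists>d. (mills has_real_derivative d) (at z) \<and> d < 0"
    using mills_has_derivative[of z] mills_pos[of z] mult_pos_pos by fastforce
qed

text \<open>After multiplication by the square of \<open>\<Phi> z\<close>, this is the log-concavity
  of \<open>\<Phi>2\<close>.\<close>

lemma trunc_var_pos: "0 < trunc_var z"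
proof -
  have "0 < (\<Phi> z * \<Phi> z - \<phi> z * \<Phi>2 z) / (\<Phi> z * \<Phi> z)"
    using phi_Phi2_less[of z] Phi_pos[of z] by (intro divide_pos_pos mult_pos_pos) auto
  also have "\<dots> = trunc_var z"
    using Phi_neq_0[of z]
    by (simp add: trunc_var_def mills_def \<Phi>2_def field_simps power2_eq_square)
  finally show ?thesis .
qed

text \<open>The distance from the truncation point down to the conditional mean has the conditional
  variance \<open>trunc_var\<close> as its derivative.\<close>

lemma mean_excess_strict_mono: "x < y \<Longrightarrow> x + mills x < y + mills y"
proof (rule DERIV_pos_imp_increasing[of _ _ "\<lambda>z. z + mills z"])
  fix z
  have "((\<lambda>z. z + mills z) has_real_derivative trunc_var z) (at z)"
    by (auto intro!: derivative_eq_intros mills_has_derivative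
        simp: trunc_var_def algebra_simps power2_eq_square)
  then show "\<exists>d. ((\<lambda>z. z + mills z) has_real_derivative d) (at z) \<and> 0 < d"
    using trunc_var_pos by blast
qed

text \<open>The derivative is \<open>mills z\<close> times a factor which, written with
  \<open>\<Phi>2\<close> and \<open>\<Phi>3\<close>, is positive by the log-concavity of
  \<open>\<Phi>3\<close>.\<close>

lemma trunc_var_strict_mono: "x < y \<Longrightarrow> trunc_var x < trunc_var y"
proof (rule DERIV_pos_imp_increasing[of _ _ trunc_var])
  fix z
  let ?d = "mills z * (2 * (mills z)\<^sup>2 + 3 * z * mills z + z\<^sup>2 - 1)"
  have "(trunc_var has_real_derivative ?d) (at z)"
    unfolding trunc_var_def[abs_def]
    by (auto intro!: derivative_eq_intros mills_has_derivative
        simp: algebra_simps power2_eq_square)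
  moreover have "0 < ?d"
  proof -
    have "0 < 2 * (\<Phi>2 z * \<Phi>2 z - \<Phi> z * \<Phi>3 z) / (\<Phi> z)\<^sup>2"
      using Phi_Phi3_less[of z] Phi_pos[of z] by (intro divide_pos_pos mult_pos_pos) auto
    also have "\<dots> = 2 * (mills z)\<^sup>2 + 3 * z * mills z + z\<^sup>2 - 1"
      using Phi_neq_0[of z]
      by (simp add: mills_def \<Phi>2_def \<Phi>3_def field_simps power2_eq_square)
    finally show ?thesis
      using mills_pos[of z] by simp
  qed
  ultimately show "\<exists>d. (trunc_var has_real_derivative d) (at z) \<and> 0 < d"
    by blast
qed

section \<open>Divergence between histories\<close>

lemma (in pair_sigma_finite) has_bochner_integral_product:
  fixes f :: "'a \<Rightarrow> real" and h :: "'b \<Rightarrow> real"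
  assumes f: "has_bochner_integral M1 f A" and h: "has_bochner_integral M2 h B"
  shows "has_bochner_integral (M1 \<Otimes>\<^sub>M M2) (\<lambda>(x, y). f x * h y) (A * B)"
proof -
  note fh = f[unfolded has_bochner_integral_iff] h[unfolded has_bochner_integral_iff]
  have [measurable]: "f \<in> borel_measurable M1" "h \<in> borel_measurable M2"
    using fh by auto
  have int: "integrable (M1 \<Otimes>\<^sub>M M2) (\<lambda>(x, y). f x * h y)"
    using fh by (intro Fubini_integrable) (auto simp: abs_mult)
  then have "integral\<^sup>L (M1 \<Otimes>\<^sub>M M2) (\<lambda>(x, y). f x * h y) = (\<integral>x. (\<integral>y. f x * h y \<partial>M2) \<partial>M1)"
    by (rule integral_fst[symmetric])
  also have "\<dots> = A * B"
    using fh by simp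
  finally show ?thesis
    using int by (simp add: has_bochner_integral_iff)
qed

interpretation std_normal_pair: pair_prob_space std_normal std_normal
  by unfold_locales

lemma sets_normal_law [simp, measurable_cong]: "sets (normal_law m v) = sets borel"
  by (simp add: normal_law_def)

section \<open>Integrals against the joint law of the two draws\<close>

lemma nn_integral_Psi:
  assumes v: "0 \<le> v1" "0 \<le> v2" and F [measurable]: "F \<in> borel_measurable (borel \<Otimes>\<^sub>M borel)"
  shows "(\<integral>\<^sup>+p. F p \<partial>Psi m1 m2 v1 v2 g) =
    (\<integral>\<^sup>+x. \<integral>\<^sup>+y. F (x, y) \<partial>normal_law (m2 - g * (x - m1)) v2 \<partial>normal_law m1 v1)"
proof -
  note [measurable] = normal_law_measurable[OF v(2)]
  have 1: "(\<lambda>x. normal_law (m2 - g * (x - m1)) v2 \<bind> (\<lambda>y. return (borel \<Otimes>\<^sub>M borel) (x, y)))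
      \<in> normal_law m1 v1 \<rightarrow>\<^sub>M prob_algebra (borel \<Otimes>\<^sub>M borel)"
    by measurable
  have 2: "(\<lambda>y. return (borel \<Otimes>\<^sub>M borel) (x, y))
      \<in> normal_law (m2 - g * (x - m1)) v2 \<rightarrow>\<^sub>M prob_algebra (borel \<Otimes>\<^sub>M borel)" for x :: real
    by measurable
  show ?thesis
    unfolding Psi_def
      nn_integral_bind[OF F measurable_prob_algebraD[OF 1]]
      nn_integral_bind[OF F measurable_prob_algebraD[OF 2]]
    by (simp add: nn_integral_return space_pair_measure)
qed

lemma nn_integral_normal_law:
  assumes "0 \<le> v" and [measurable]: "f \<in> borel_measurable borel"
  shows "(\<integral>\<^sup>+x. f x \<partial>normal_law m v) = (\<integral>\<^sup>+z. f (m + sqrt v * z) \<partial>std_normal)"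
  by (subst normal_law_eq_distr[OF assms(1)]) (simp add: nn_integral_distr)

text \<open>Standardizing both draws turns the conditional construction into the image of two
  independent standard normals, so that expectations reduce to products of moments. Zero variances
  are covered.\<close>

lemma Psi_eq_distr:
  assumes v: "0 \<le> v1" "0 \<le> v2"
  shows "Psi m1 m2 v1 v2 g = distr (std_normal \<Otimes>\<^sub>M std_normal) (borel \<Otimes>\<^sub>M borel)
    (\<lambda>(z, w). (m1 + sqrt v1 * z, m2 - g * (sqrt v1 * z) + sqrt v2 * w))"
    (is "_ = distr _ _ ?T")
proof (rule measure_eqI)
  fix A assume "A \<in> sets (Psi m1 m2 v1 v2 g)"
  then have A [measurable]: "A \<in> sets (borel \<Otimes>\<^sub>M borel)"
    using sets_Psi[OF v] by auto
  note [measurable] = normal_law_measurable[OF v(2)]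
  have "emeasure (Psi m1 m2 v1 v2 g) A = (\<integral>\<^sup>+p. indicator A p \<partial>Psi m1 m2 v1 v2 g)"
    using A sets_Psi[OF v] by simp
  also have "\<dots> = (\<integral>\<^sup>+x. \<integral>\<^sup>+w. indicator A (x, m2 - g * (x - m1) + sqrt v2 * w)
      \<partial>std_normal \<partial>normal_law m1 v1)"
    by (simp add: nn_integral_Psi[OF v] nn_integral_normal_law[OF v(2)])
  also have "\<dots> = (\<integral>\<^sup>+z. \<integral>\<^sup>+w. indicator A (?T (z, w)) \<partial>std_normal \<partial>std_normal)"
    by (subst nn_integral_normal_law[OF v(1)]) simp_all
  also have "\<dots> = (\<integral>\<^sup>+p. indicator A (?T p) \<partial>(std_normal \<Otimes>\<^sub>M std_normal))"
    by (rule std_normal.nn_integral_fst) simp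
  also have "\<dots> = emeasure (distr (std_normal \<Otimes>\<^sub>M std_normal) (borel \<Otimes>\<^sub>M borel) ?T) A"
    by (simp add: nn_integral_distr flip: nn_integral_indicator)
  finally show "emeasure (Psi m1 m2 v1 v2 g) A = \<dots>" .
qed (simp add: sets_Psi[OF v])

lemma the_measurable_option_borel [measurable]: "the \<in> option_borel \<rightarrow>\<^sub>M borel"
  by (rule measurableI) (auto simp: sets_option_borel vimage_def)

lemma is_None_measurable_option_borel [measurable]:
  "Measurable.pred option_borel (\<lambda>x. x = None)"
  by (auto simp: pred_def sets_option_borel vimage_def)

section \<open>Likelihood ratio and divergence for positive variances\<close>

lemma normal_density_ln_ratio:
  assumes "0 < v" "0 < v'"
  shows "ln (normal_density m (sqrt v) x / normal_density m' (sqrt v') x) =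
    (ln (v' / v) - (x - m)\<^sup>2 / v + (x - m')\<^sup>2 / v') / 2"
proof -
  have ln_density: "ln (normal_density m (sqrt v) x) = - (ln (2 * pi * v) + (x - m)\<^sup>2 / v) / 2"
    if "0 < v" for m v
    using that
    by (simp add: normal_density_def ln_mult ln_div ln_sqrt field_simps)
  have "normal_density m (sqrt v) x \<noteq> 0" "normal_density m' (sqrt v') x \<noteq> 0"
    using normal_density_pos[of "sqrt v" m x] normal_density_pos[of "sqrt v'" m' x] assms by auto
  then show ?thesis
    using assms by (simp add: ln_div ln_density normal_density_pos ln_mult field_simps)
qed

lemma normal_density_measurable2 [measurable (raw)]:
  assumes [measurable]: "f \<in> borel_measurable M" "h \<in> borel_measurable M"
  shows "(\<lambda>x. normal_density (f x) s (h x)) \<in> borel_measurable M"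
  unfolding normal_density_def by measurable

text \<open>The true parameters are \<open>a\<close>, \<open>b\<close> and \<open>vt\<close>. A
  censored history carries only the first factor, since both conditional densities of the second
  draw integrate to 1. No \<open>g\<close> enters the numerator, the true draws being
  independent.\<close>

definition likelihood_ratio ::
    "real \<Rightarrow> real \<Rightarrow> real \<Rightarrow> real \<Rightarrow> real \<Rightarrow> real \<Rightarrow> real \<Rightarrow> real \<Rightarrow> real \<times> real option \<Rightarrow> real" where
  "likelihood_ratio a b vt m1 m2 v1 v2 g = (\<lambda>(x, y).
     normal_density a (sqrt vt) x / normal_density m1 (sqrt v1) x *
     (if y = None then 1 else normal_density b (sqrt vt) (the y) /
        normal_density (m2 - g * (x - m1)) (sqrt v2) (the y)))"

lemma likelihood_ratio_measurable [measurable]: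
  "likelihood_ratio a b vt m1 m2 v1 v2 g \<in> borel_measurable (borel \<Otimes>\<^sub>M option_borel)"
  unfolding likelihood_ratio_def by measurable

lemma sets_history_law [simp, measurable_cong]:
  "sets (history_law P c) = sets (borel \<Otimes>\<^sub>M option_borel)"
  by (simp add: history_law_def)

lemma nn_integral_history_law:
  assumes v: "0 \<le> v1" "0 \<le> v2"
    and F [measurable]: "(F :: _ \<Rightarrow> ennreal) \<in> borel_measurable (borel \<Otimes>\<^sub>M option_borel)"
  shows "(\<integral>\<^sup>+p. F p \<partial>history_law (Psi m1 m2 v1 v2 g) c) =
    (\<integral>\<^sup>+x. \<integral>\<^sup>+y. F (censor c (x, y)) \<partial>normal_law (m2 - g * (x - m1)) v2 \<partial>normal_law m1 v1)"
proof -
  note [measurable_cong] = sets_Psi[OF v]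
  have "(\<integral>\<^sup>+p. F p \<partial>history_law (Psi m1 m2 v1 v2 g) c) =
      (\<integral>\<^sup>+p. F (censor c p) \<partial>Psi m1 m2 v1 v2 g)"
    unfolding history_law_def by (rule nn_integral_distr) measurable
  then show ?thesis
    by (simp add: nn_integral_Psi[OF v])
qed

lemma nn_integral_history_law_density:
  assumes v: "0 < v1" "0 < v2"
    and F [measurable]: "(F :: _ \<Rightarrow> ennreal) \<in> borel_measurable (borel \<Otimes>\<^sub>M option_borel)"
  shows "(\<integral>\<^sup>+p. F p \<partial>history_law (Psi m1 m2 v1 v2 g) c) =
    (\<integral>\<^sup>+x. ennreal (normal_density m1 (sqrt v1) x) *
      (\<integral>\<^sup>+y. ennreal (normal_density (m2 - g * (x - m1)) (sqrt v2) y) * F (censor c (x, y)) \<partial>lborel) \<partial>lborel)"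
proof -
  have law: "normal_law m v = density lborel (\<lambda>x. ennreal (normal_density m (sqrt v) x))"
    if "0 < v" for m v
    using that by (simp add: normal_law_def)
  show ?thesis
    using v by (simp add: nn_integral_history_law law nn_integral_density)
qed

text \<open>Both sides are compared first draw by first draw. Above the cutoff the second draw
  integrates out; below it the denominators of the ratio cancel the subjective densities.\<close>

lemma true_history_eq_density:
  assumes v: "0 < vt" "0 < v1" "0 < v2"
  shows "true_history a b vt c =
    density (history_law (Psi m1 m2 v1 v2 g) c) 
      (\<lambda>p. ennreal (likelihood_ratio a b vt m1 m2 v1 v2 g p))"
    (is "?P = density ?Q (\<lambda>p. ennreal (?r p))")
proof (rule measure_eqI)
  fix A assume "A \<in> sets ?P"
  then have A [measurable]: "A \<in> sets (borel \<Otimes>\<^sub>M option_borel)"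
    by (simp add: true_history_def)
  let ?I = "\<lambda>x y. indicator A (censor c (x, y)) :: ennreal"
  let ?n = "\<lambda>m v x. ennreal (normal_density m (sqrt v) x)"
  have pos: "0 < normal_density m (sqrt v) x" if "0 < v" for m v x
    using that by (simp add: normal_density_pos)
  have int_1: "(\<integral>\<^sup>+y. ?n m v y * C \<partial>lborel) = C" if "0 < v" for m v and C :: ennreal
  proof -
    interpret prob_space "density lborel (?n m v)"
      by (rule prob_space_normal_density) (use that in simp)
    have "(\<integral>\<^sup>+y. ?n m v y \<partial>lborel) = 1"
      using emeasure_space_1 by (simp add: emeasure_density)
    then show ?thesis
      by (simp add: nn_integral_multc)
  qed
  have inner: "?n a vt x * (\<integral>\<^sup>+y. ?n b vt y * ?I x y \<partial>lborel) =
      ?n m1 v1 x * (\<integral>\<^sup>+y. ?n (m2 - g * (x - m1)) v2 y *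
        (ennreal (?r (censor c (x, y))) * ?I x y) \<partial>lborel)" for x
  proof (cases "x > c")
    case True
    then show ?thesis
      using v pos[OF v(2), of m1 x]
      by (simp add: censor_def int_1 likelihood_ratio_def)
        (simp flip: mult.assoc ennreal_mult')
  next
    case False
    have "(\<integral>\<^sup>+y. ?n (m2 - g * (x - m1)) v2 y *
        (ennreal (?r (censor c (x, y))) * ?I x y) \<partial>lborel) =
      (\<integral>\<^sup>+y. ennreal (normal_density a (sqrt vt) x / normal_density m1 (sqrt v1) x) *
        (?n b vt y * ?I x y) \<partial>lborel)"
    proof (rule nn_integral_cong)
      fix y
      let ?\<rho> = "normal_density a (sqrt vt) x / normal_density m1 (sqrt v1) x"
      let ?d = "normal_density (m2 - g * (x - m1)) (sqrt v2) y"
      have "?d * ?r (censor c (x, y)) = ?\<rho> * normal_density b (sqrt vt) y"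
        using False pos[OF v(3), of "m2 - g * (x - m1)" y]
        by (simp add: censor_def likelihood_ratio_def)
      then have "ennreal ?d * ennreal (?r (censor c (x, y))) = ennreal ?\<rho> * ?n b vt y"
        by (simp flip: ennreal_mult')
      then show "ennreal ?d * (ennreal (?r (censor c (x, y))) * ?I x y) = ennreal ?\<rho> * (?n b vt y * ?I x y)"
        by (simp only: mult.assoc[symmetric])
    qed
    also have "\<dots> = ennreal (normal_density a (sqrt vt) x / normal_density m1 (sqrt v1) x) *
        (\<integral>\<^sup>+y. ?n b vt y * ?I x y \<partial>lborel)"
      by (rule nn_integral_cmult) simp
    finally show ?thesis
      using pos[OF v(2), of m1 x] by (simp flip: mult.assoc ennreal_mult')
  qed
  have "emeasure ?P A = (\<integral>\<^sup>+p. indicator A p \<partial>?P)"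
    using A by (simp add: true_history_def)
  also have "\<dots> = (\<integral>\<^sup>+x. ?n a vt x *
      (\<integral>\<^sup>+y. ?n b vt y * ?I x y \<partial>lborel) \<partial>lborel)"
    using v
    by (simp add: true_history_def nn_integral_history_law_density del: nn_integral_indicator)
  also have "\<dots> = (\<integral>\<^sup>+p. ennreal (?r p) * indicator A p \<partial>?Q)"
    using v by (simp add: inner nn_integral_history_law_density)
  also have "\<dots> = emeasure (density ?Q (\<lambda>p. ennreal (?r p))) A"
    by (simp add: emeasure_density)
  finally show "emeasure ?P A = emeasure (density ?Q (\<lambda>p. ennreal (?r p))) A" .
qed (simp add: true_history_def)

text \<open>Radon-Nikodym derivatives are unique up to Q-null sets. By absolute continuity these are
  P-null too, so r may replace the derivative under the P-integral.\<close>

lemma kl_div_density: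
  assumes "prob_space Q" and [measurable]: "r \<in> borel_measurable Q" and r: "\<And>x. 0 \<le> r x"
    and P: "P = density Q (\<lambda>x. ennreal (r x))" and int: "integrable P (\<lambda>x. ln (r x))"
  shows "kl_div P Q = ereal (\<integral>x. ln (r x) \<partial>P)"
proof -
  interpret Q: prob_space Q by fact
  have [measurable_cong]: "sets P = sets Q"
    by (simp add: P)
  have "AE x in Q. ennreal (r x) = RN_deriv Q P x"
    by (rule Q.RN_deriv_unique) (simp_all add: P)
  moreover have ac: "absolutely_continuous Q P"
    unfolding P by (rule absolutely_continuousI_density) simp
  ultimately have "AE x in P. ennreal (r x) = RN_deriv Q P x"
    by (intro absolutely_continuous_AE[OF _ ac]) (simp_all add: P)
  then have AE: "AE x in P. entropy_density (exp 1) Q P x = ln (r x)"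
  proof eventually_elim
    case (elim x)
    then have "enn2real (RN_deriv Q P x) = r x"
      using r by (metis enn2real_ennreal)
    then show ?case
      by (simp add: entropy_density_def log_def)
  qed
  have "integrable P (entropy_density (exp 1) Q P)"
    using AE int by (subst integrable_cong_AE) auto
  moreover have "(\<integral>x. entropy_density (exp 1) Q P x \<partial>P) = (\<integral>x. ln (r x) \<partial>P)"
    using AE by (intro integral_cong_AE) auto
  ultimately show ?thesis
    using ac by (simp add: kl_div_def KL_divergence_def)
qed

text \<open>In standardized draws the log ratio is a quadratic polynomial, with the second-draw part
  switched on only for \<open>x \<le> z\<close>. Its expectation needs only the moments computed
  above. The mean squared prediction error splits into a variance and the squared bias at the
  conditional mean of the first draw.\<close>

lemma kl_div_history:
  fixes a b c vt m1 m2 v1 v2 g :: real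
  assumes v: "0 < vt" "0 < v1" "0 < v2"
  defines "z \<equiv> (c - a) / sqrt vt"
  shows "kl_div (true_history a b vt c) (history_law (Psi m1 m2 v1 v2 g) c) =
    ereal ((ln (v1 / vt) - 1 + (vt + (a - m1)\<^sup>2) / v1) / 2 +
      \<Phi> z * (ln (v2 / vt) - 1 + (vt * (1 + g\<^sup>2 * trunc_var z) +
        (b - m2 + g * (a - sqrt vt * mills z - m1))\<^sup>2) / v2) / 2)"
    (is "kl_div ?P ?Q = ereal ?K")
proof -
  let ?r = "likelihood_ratio a b vt m1 m2 v1 v2 g"
  let ?N = "std_normal \<Otimes>\<^sub>M std_normal"
  define s where "s = sqrt vt"
  have s: "0 < s" "s\<^sup>2 = vt"
    using v by (auto simp: s_def)
  \<comment> \<open>The bias of the predicted second draw after a first draw equal to its true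
    mean.\<close>
  define L where "L = b - m2 + g * (a - m1)"
  define I :: "real \<Rightarrow> real" where "I = indicator {..z}"
  let ?T = "\<lambda>(x, w). (a + s * x, b + s * w)"
  have True_eq: "?P = distr ?N (borel \<Otimes>\<^sub>M option_borel) (\<lambda>p. censor c (?T p))"
    unfolding true_history_def history_law_def using v
    by (simp add: Psi_eq_distr distr_distr comp_def s_def split_beta')
  \<comment> \<open>The factors 1 make every summand a function of \<open>x\<close> times one of \<open>w\<close>, to be integrated separately.\<close>
  define G where "G = (\<lambda>(x, w).
      (ln (v1 / vt) + (a - m1)\<^sup>2 / v1) / 2 * (1::real) + s * (a - m1) / v1 * (x * 1) +
      (vt / v1 - 1) / 2 * (x\<^sup>2 * 1) +
      (ln (v2 / vt) + L\<^sup>2 / v2) / 2 * (I x * 1) + L * g * s / v2 * (I x * x * 1) +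
      g\<^sup>2 * vt / v2 / 2 * (I x * x\<^sup>2 * 1) + L * s / v2 * (I x * w) + g * vt / v2 * (I x * x * w) +
      (vt / v2 - 1) / 2 * (I x * w\<^sup>2))"
  have pos: "0 < normal_density m (sqrt v) x" if "0 < v" for m v x
    using that by (simp add: normal_density_pos)
  have expand1: "(l1 - x\<^sup>2 + (d + s * x)\<^sup>2 / v1) / 2 =
      (l1 + d\<^sup>2 / v1) / 2 + s * d / v1 * x + (s\<^sup>2 / v1 - 1) / 2 * x\<^sup>2" for l1 d x
    by (simp add: power2_eq_square add_divide_distrib diff_divide_distrib algebra_simps)
  have expand2: "(l2 - w\<^sup>2 + (L + s * w + g * s * x)\<^sup>2 / v2) / 2 =
      (l2 + L\<^sup>2 / v2) / 2 + L * g * s / v2 * x + g\<^sup>2 * s\<^sup>2 / v2 / 2 * x\<^sup>2 + L * s / v2 * w +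
      g * s\<^sup>2 / v2 * (x * w) + (s\<^sup>2 / v2 - 1) / 2 * w\<^sup>2" for l2 w x
    by (simp add: power2_eq_square add_divide_distrib diff_divide_distrib algebra_simps)
  have ln_r: "ln (?r (censor c (?T p))) = G p" for p
  proof (cases p)
    case (Pair x w)
    have first: "ln (normal_density a (sqrt vt) (a + s * x) / normal_density m1 (sqrt v1) (a + s * x)) =
        (ln (v1 / vt) - x\<^sup>2 + (a - m1 + s * x)\<^sup>2 / v1) / 2"
      unfolding normal_density_ln_ratio[OF v(1,2)] using v(1)
      by (simp add: power_mult_distrib s diff_add_eq)
    have second: "ln (normal_density b (sqrt vt) (b + s * w) /
          normal_density (m2 - g * (a + s * x - m1)) (sqrt v2) (b + s * w)) =
        (ln (v2 / vt) - w\<^sup>2 + (L + s * w + g * s * x)\<^sup>2 / v2) / 2"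
      unfolding normal_density_ln_ratio[OF v(1,3)] using v(1)
      by (simp add: power_mult_distrib s L_def) (simp add: algebra_simps)
    have pos': "0 < normal_density a (sqrt vt) (a + s * x) / normal_density m1 (sqrt v1) (a + s * x)"
      "0 < normal_density b (sqrt vt) (b + s * w) /
          normal_density (m2 - g * (a + s * x - m1)) (sqrt v2) (b + s * w)"
      using v pos by simp_all
    show ?thesis
    proof (cases "x \<le> z")
      case True
      then have "\<not> c < a + s * x"
        using s by (simp add: z_def field_simps flip: s_def)
      then have "?r (censor c (?T p)) =
          normal_density a (sqrt vt) (a + s * x) / normal_density m1 (sqrt v1) (a + s * x) *
          (normal_density b (sqrt vt) (b + s * w) /
            normal_density (m2 - g * (a + s * x - m1)) (sqrt v2) (b + s * w))"
        by (simp add: Pair censor_def likelihood_ratio_def)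
      then have "ln (?r (censor c (?T p))) =
          (ln (v1 / vt) - x\<^sup>2 + (a - m1 + s * x)\<^sup>2 / v1) / 2 +
          (ln (v2 / vt) - w\<^sup>2 + (L + s * w + g * s * x)\<^sup>2 / v2) / 2"
        unfolding first[symmetric] second[symmetric] using ln_mult_pos[OF pos'] by simp
      moreover have "I x = 1"
        using True by (simp add: I_def)
      ultimately show ?thesis
        unfolding expand1 expand2 G_def Pair by (simp add: s)
    next
      case False
      then have "c < a + s * x"
        using s by (simp add: z_def field_simps flip: s_def)
      then have "ln (?r (censor c (?T p))) = (ln (v1 / vt) - x\<^sup>2 + (a - m1 + s * x)\<^sup>2 / v1) / 2"
        unfolding first[symmetric] by (simp add: Pair censor_def likelihood_ratio_def)
      moreover have "I x = 0"
        using False by (simp add: I_def)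
      ultimately show ?thesis
        unfolding expand1 G_def Pair by (simp add: s)
    qed
  qed
  have one: "has_bochner_integral std_normal (\<lambda>_. 1 :: real) 1"
    using std_normal.prob_space by (simp add: has_bochner_integral_iff)
  note product = std_normal_pair.has_bochner_integral_product[unfolded split_beta]
  note I_moments = truncated_moment_0[of z, folded I_def]
    truncated_moment_1[of z, folded I_def] truncated_moment_2[of z, folded I_def]
  note moments = product[OF std_normal_moment_1 one] product[OF std_normal_moment_2 one]
    product[OF I_moments(1) one] product[OF I_moments(2) one] product[OF I_moments(3) one]
    product[OF I_moments(1) std_normal_moment_1] product[OF I_moments(2) std_normal_moment_1]
    product[OF I_moments(1) std_normal_moment_2]
  have const: "has_bochner_integral ?N (\<lambda>_. 1 :: real) (1 * 1)"
    using product[OF one one] by simp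
  have "has_bochner_integral ?N G
     ((ln (v1 / vt) + (a - m1)\<^sup>2 / v1) / 2 * (1 * 1) + s * (a - m1) / v1 * (0 * 1) +
      (vt / v1 - 1) / 2 * (1 * 1) +
      (ln (v2 / vt) + L\<^sup>2 / v2) / 2 * (\<Phi> z * 1) + L * g * s / v2 * (- \<phi> z * 1) +
      g\<^sup>2 * vt / v2 / 2 * ((\<Phi> z - z * \<phi> z) * 1) + L * s / v2 * (\<Phi> z * 0) + g * vt / v2 * (- \<phi> z * 0) +
      (vt / v2 - 1) / 2 * (\<Phi> z * 1))"
    (is "has_bochner_integral _ _ ?J")
    unfolding G_def split_beta
    by (intro has_bochner_integral_add has_bochner_integral_mult_right
        const moments)
  also have "?J = ?K"
  proof -
    \<comment> \<open>With m the value of \<open>mills z\<close>, completing the square in L leaves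
      \<open>trunc_var z\<close> as the coefficient of \<open>vt * g\<^sup>2\<close>.\<close>
    have collect: "p * (l2 - 1 + (vt * (1 + g\<^sup>2 * (1 - z * m - m\<^sup>2)) + (L - g * s * m)\<^sup>2) / v2) / 2 =
        (l2 + L\<^sup>2 / v2) / 2 * p + L * g * s / v2 * (- (m * p)) +
        g\<^sup>2 * vt / v2 / 2 * (p - z * (m * p)) + (vt / v2 - 1) / 2 * p" for p l2 m
      unfolding s(2)[symmetric]
      by (simp add: power2_eq_square add_divide_distrib diff_divide_distrib algebra_simps)
    have phi: "\<phi> z = mills z * \<Phi> z"
      by (simp add: mills_def)
    have L: "b - m2 + g * (a - s * mills z - m1) = L - g * s * mills z"
      by (simp add: L_def algebra_simps)
    have first: "(l1 + d / v1) / 2 * (1 * 1) + e * (0 * 1) + (vt / v1 - 1) / 2 * (1 * 1) =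
        (l1 - 1 + (vt + d) / v1) / 2" for l1 d e
      by (simp add: add_divide_distrib diff_divide_distrib)
    show ?thesis
      unfolding trunc_var_def s_def[symmetric] L collect phi first by simp
  qed
  finally have G: "has_bochner_integral ?N G ?K" .
  have int: "integrable ?P (\<lambda>p. ln (?r p))"
    using G unfolding True_eq by (subst integrable_distr_eq) (simp_all add: ln_r has_bochner_integral_iff)
  have "kl_div ?P ?Q = ereal (\<integral>p. ln (?r p) \<partial>?P)"
  proof (rule kl_div_density)
    show "prob_space ?Q"
      unfolding history_law_def using v prob_space_Psi[of v1 v2] sets_Psi[of v1 v2]
      by (intro prob_space.prob_space_distr) (auto cong: measurable_cong_sets)
    show "0 \<le> ?r x" for x
      by (simp add: likelihood_ratio_def split: prod.split)
  qed (use v int true_history_eq_density in auto)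
  also have "(\<integral>p. ln (?r p) \<partial>?P) = ?K"
    using G unfolding True_eq by (subst integral_distr) (simp_all add: ln_r has_bochner_integral_iff)
  finally show ?thesis .
qed

section \<open>Infinite divergence at zero variances\<close>

lemma lborel_not_AE_notin_interval:
  fixes u v :: real
  assumes "u < v" shows "\<not> (AE x in lborel. x \<notin> {u<..<v})"
proof
  assume "AE x in lborel. x \<notin> {u<..<v}"
  then have "emeasure lborel {u<..<v} = 0"
    by (subst (asm) AE_iff_null_sets[symmetric]) auto
  then show False
    using assms by simp
qed

text \<open>The true normal densities are positive everywhere, so a null set of histories is avoided
  for Lebesgue-almost all pairs of draws.\<close>

lemma AE_of_true_history_null:
  assumes vt: "0 < vt" and A [measurable]: "A \<in> sets (borel \<Otimes>\<^sub>M option_borel)"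
    and null: "emeasure (true_history a b vt c) A = 0"
  shows "AE x in lborel. AE y in lborel. censor c (x, y) \<notin> A"
proof -
  have pos: "0 < normal_density m (sqrt vt) x" for m x
    using vt by (simp add: normal_density_pos)
  have "(\<integral>\<^sup>+p. indicator A p \<partial>true_history a b vt c) = 0"
    using null A by (simp add: true_history_def)
  then have "(\<integral>\<^sup>+x. ennreal (normal_density a (sqrt vt) x) *
      (\<integral>\<^sup>+y. ennreal (normal_density (b - 0 * (x - a)) (sqrt vt) y) * indicator A (censor c (x, y))
        \<partial>lborel) \<partial>lborel) = 0"
    unfolding true_history_def using vt by (subst (asm) nn_integral_history_law_density) auto
  then have "AE x in lborel. (\<integral>\<^sup>+y. ennreal (normal_density b (sqrt vt) y) *
      indicator A (censor c (x, y)) \<partial>lborel) = 0"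
    using less_imp_neq[OF pos] pos
    by (subst (asm) nn_integral_0_iff_AE) (auto simp: not_le[symmetric])
  then show ?thesis
  proof eventually_elim
    case (elim x)
    have "AE y in lborel. ennreal (normal_density b (sqrt vt) y) * indicator A (censor c (x, y)) = 0"
      using elim by (subst (asm) nn_integral_0_iff_AE) auto
    then show ?case
      by eventually_elim (auto simp: indicator_def not_le less_imp_neq[OF pos, symmetric] pos split: if_splits)
  qed
qed

lemma AE_normal_law_0: "AE x in normal_law m 0. x = m"
  unfolding normal_law_def by (subst if_P) (simp_all add: AE_return)

text \<open>A zero variance confines the subjective law to histories that do not carry all of the
  true law. Absolute continuity then fails, and \<open>kl_div\<close> takes its infinite
  branch.\<close>

lemma kl_div_history_degenerate:
  assumes vt: "0 < vt" and v: "0 \<le> v1" "0 \<le> v2" "v1 = 0 \<or> v2 = 0"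
  shows "kl_div (true_history a b vt c) (history_law (Psi m1 m2 v1 v2 g) c) = \<infinity>"
    (is "kl_div ?P ?Q = _")
proof -
  have "\<not> absolutely_continuous ?Q ?P"
  proof
    assume ac: "absolutely_continuous ?Q ?P"
    have null: "AE x in lborel. AE y in lborel. censor c (x, y) \<notin> A"
      if A: "A \<in> sets (borel \<Otimes>\<^sub>M option_borel)"
        and Q: "(\<integral>\<^sup>+x. \<integral>\<^sup>+y. indicator A (censor c (x, y))
          \<partial>normal_law (m2 - g * (x - m1)) v2 \<partial>normal_law m1 v1) = 0" for A
    proof (rule AE_of_true_history_null[OF vt A])
      have "(\<integral>\<^sup>+p. indicator A p \<partial>?Q) = 0"
        unfolding nn_integral_history_law[OF v(1,2) borel_measurable_indicator[OF A]] by (rule Q)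
      then have "A \<in> null_sets ?Q"
        using A by (intro null_setsI) auto
      then show "emeasure ?P A = 0"
        using ac by (auto simp: absolutely_continuous_def)
    qed
    show False
    proof (cases "v1 = 0")
      case True
      \<comment> \<open>With \<open>v1 = 0\<close>, the subjective law gives no mass to first draws
        other than \<open>m1\<close>.\<close>
      have "AE x in lborel. AE y in lborel. censor c (x, y) \<notin> (- {m1}) \<times> UNIV"
      proof (rule null)
        show "(- {m1}) \<times> UNIV \<in> sets (borel \<Otimes>\<^sub>M option_borel)"
          using sets.top[of option_borel] by (intro pair_measureI) auto
        show "(\<integral>\<^sup>+x. \<integral>\<^sup>+y. indicator ((- {m1}) \<times> UNIV) (censor c (x, y))
          \<partial>normal_law (m2 - g * (x - m1)) v2 \<partial>normal_law m1 v1) = 0"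
        proof -
          have "AE x in normal_law m1 v1. x = m1"
            unfolding True by (rule AE_normal_law_0)
          then have "(\<integral>\<^sup>+x. \<integral>\<^sup>+y. indicator ((- {m1}) \<times> UNIV) (censor c (x, y))
              \<partial>normal_law (m2 - g * (x - m1)) v2 \<partial>normal_law m1 v1) = (\<integral>\<^sup>+x. 0 \<partial>normal_law m1 v1)"
            by (intro nn_integral_cong_AE) (auto simp: censor_def elim!: eventually_mono)
          then show ?thesis by simp
        qed
      qed
      then have "AE x in lborel. x \<notin> {m1<..<m1 + 1}"
      proof eventually_elim
        case (elim x)
        have "x = m1"
        proof (rule ccontr)
          assume "x \<noteq> m1"
          then have "AE y in lborel. y \<notin> {0<..<1 :: real}"
            using elim by (auto simp: censor_def)
          then show False
            using lborel_not_AE_notin_interval[of 0 1] by simp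
        qed
        then show ?case by simp
      qed
      then show False
        using lborel_not_AE_notin_interval[of m1 "m1 + 1"] by simp
    next
      case False
      then have v2: "v2 = 0"
        using v by simp
      \<comment> \<open>With \<open>v2 = 0\<close>, an observed second draw lies almost surely on
        the subjective regression line; \<open>?A\<close> collects the observed deviations from
        it.\<close>
      let ?A = "{p. snd p \<noteq> None \<and> the (snd p) \<noteq> m2 - g * (fst p - m1)}"
      have "AE x in lborel. AE y in lborel. censor c (x, y) \<notin> ?A"
      proof (rule null)
        have "{p \<in> space (borel \<Otimes>\<^sub>M option_borel). snd p \<noteq> None \<and> the (snd p) \<noteq> m2 - g * (fst p - m1)}
            \<in> sets (borel \<Otimes>\<^sub>M option_borel)"
          by measurable
        then show "?A \<in> sets (borel \<Otimes>\<^sub>M option_borel)"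
          by (simp add: space_pair_measure)
        have "(\<integral>\<^sup>+y. indicator ?A (censor c (x, y)) \<partial>normal_law (m2 - g * (x - m1)) v2) = (0 :: ennreal)"
          for x
        proof -
          have "(\<integral>\<^sup>+y. indicator ?A (censor c (x, y)) \<partial>normal_law (m2 - g * (x - m1)) v2) =
              (\<integral>\<^sup>+y. 0 \<partial>normal_law (m2 - g * (x - m1)) v2)"
            using AE_normal_law_0[of "m2 - g * (x - m1)"] unfolding v2
            by (intro nn_integral_cong_AE) (auto simp: censor_def elim!: eventually_mono)
          then show ?thesis by simp
        qed
        then show "(\<integral>\<^sup>+x. \<integral>\<^sup>+y. indicator ?A (censor c (x, y))
          \<partial>normal_law (m2 - g * (x - m1)) v2 \<partial>normal_law m1 v1) = 0"
          by simp
      qed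
      \<comment> \<open>The second draw is seen only after first draws up to c, so the contradiction
        needs an interval to the left of c.\<close>
      then have "AE x in lborel. x \<notin> {c - 1<..<c}"
      proof eventually_elim
        case (elim x)
        let ?k = "m2 - g * (x - m1)"
        show ?case
        proof
          assume "x \<in> {c - 1<..<c}"
          then have "AE y in lborel. y \<notin> {?k<..<?k + 1}"
            using elim by (auto simp: censor_def elim!: eventually_mono)
          then show False
            using lborel_not_AE_notin_interval[of ?k "?k + 1"] by simp
        qed
      qed
      then show False
        using lborel_not_AE_notin_interval[of "c - 1" c] by simp
    qed
  qed
  then show ?thesis
    by (simp add: kl_div_def)
qed

text \<open>Both parts come from \<open>ln x \<le> x - 1\<close> at \<open>x = A0 / v\<close>, with
  equality only at 1. Here A0 is the smallest attainable mean squared error; the equality case gives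
  uniqueness of the minimizer.\<close>

lemma ln_add_ratio_ge:
  fixes v A A0 t :: real
  assumes "0 < t" "0 < v" "0 < A0" "A0 \<le> A"
  shows "ln (A0 / t) \<le> ln (v / t) - 1 + A / v"
    and "ln (v / t) - 1 + A / v = ln (A0 / t) \<Longrightarrow> v = A0 \<and> A = A0"
proof -
  have eq: "ln (A0 / v) = ln (A0 / t) - ln (v / t)"
    using assms by (simp add: ln_div)
  have le: "ln (A0 / v) \<le> A0 / v - 1"
    using assms by (intro ln_le_minus_one) simp
  have mono: "A0 / v \<le> A / v"
    using assms by (simp add: divide_right_mono)
  show "ln (A0 / t) \<le> ln (v / t) - 1 + A / v"
    using eq le mono by linarith
  assume "ln (v / t) - 1 + A / v = ln (A0 / t)"
  then have *: "ln (A0 / v) = A0 / v - 1" "A0 / v = A / v"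
    using eq le mono by linarith+
  have "A0 / v = 1"
    using assms by (intro ln_eq_minus_one[OF _ *(1)]) simp
  with *(2) show "v = A0 \<and> A = A0"
    using assms by (simp add: field_simps)
qed

text \<open>Strict comparison with one candidate gives existence and uniqueness together; uniqueness
  is what evaluates the \<open>THE\<close> in \<open>sigma2_star\<close>.\<close>

lemma is_arg_min_eq_iff:
  fixes f :: "'a \<Rightarrow> 'b :: order"
  assumes "P x" and "\<And>y. P y \<Longrightarrow> y \<noteq> x \<Longrightarrow> f x < f y"
  shows "is_arg_min f P y \<longleftrightarrow> y = x"
  using assms unfolding is_arg_min_def by (metis order_less_asym)

section \<open>Minimizers of the divergence\<close>

text \<open>The intercept for which, with \<open>m1 = a\<close>, the regression line of slope
  \<open>- g\<close> predicts the true mean b at the conditional mean of the uncensored first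
  draws.\<close>

definition fitted_mean :: "real \<Rightarrow> real \<Rightarrow> real \<Rightarrow> real \<Rightarrow> real \<Rightarrow> real" where
  "fitted_mean a b vt g c = b - g * sqrt vt * mills ((c - a) / sqrt vt)"

definition fitted_var :: "real \<Rightarrow> real \<Rightarrow> real \<Rightarrow> real \<Rightarrow> real" where
  "fitted_var a vt g c = vt * (1 + g\<^sup>2 * trunc_var ((c - a) / sqrt vt))"

lemma fitted_var_ge:
  assumes "0 < vt" shows "vt \<le> fitted_var a vt g c"
proof -
  have "0 \<le> g\<^sup>2 * trunc_var ((c - a) / sqrt vt)"
    using trunc_var_pos[of "(c - a) / sqrt vt"] by simp
  then have "vt * 1 \<le> fitted_var a vt g c"
    unfolding fitted_var_def using assms by (intro mult_left_mono) auto
  then show ?thesis by simp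
qed

lemma kl_div_history_fitted:
  assumes v: "0 < vt" "0 < v1" "0 < v2"
  shows "kl_div (true_history a b vt c) (history_law (Psi m1 m2 v1 v2 g) c) =
    ereal ((ln (v1 / vt) - 1 + (vt + (a - m1)\<^sup>2) / v1) / 2 +
      \<Phi> ((c - a) / sqrt vt) * (ln (v2 / vt) - 1 + (fitted_var a vt g c +
        (fitted_mean a b vt g c - m2 + g * (a - m1))\<^sup>2) / v2) / 2)"
proof -
  have "b - m2 + g * (a - sqrt vt * mills ((c - a) / sqrt vt) - m1) =
      fitted_mean a b vt g c - m2 + g * (a - m1)"
    by (simp add: fitted_mean_def algebra_simps)
  then show ?thesis
    by (simp only: kl_div_history[OF v] fitted_var_def)
qed

text \<open>The first-draw and second-draw terms have the lower bounds 0 and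
  \<open>ln (?V / vt)\<close> and attain both at the candidate. As the weight \<open>?w\<close> is
  positive, any other point must lose strictly in one of them.\<close>

lemma min_unknown_var_iff:
  assumes vt: "0 < vt"
  shows "min_unknown_var a b vt g c p \<longleftrightarrow> p = (a, fitted_mean a b vt g c, vt, fitted_var a vt g c)"
  unfolding min_unknown_var_def
proof (rule is_arg_min_eq_iff)
  let ?V = "fitted_var a vt g c" and ?m = "fitted_mean a b vt g c"
  let ?w = "\<Phi> ((c - a) / sqrt vt)"
  have V: "0 < ?V"
    using fitted_var_ge[OF vt, of a g c] vt by linarith
  then show "case (a, ?m, vt, ?V) of (m1, m2, v1, v2) \<Rightarrow> 0 \<le> v1 \<and> 0 \<le> v2"
    using vt by simp
  fix p :: "real \<times> real \<times> real \<times> real"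
  assume nonneg: "case p of (m1, m2, v1, v2) \<Rightarrow> 0 \<le> v1 \<and> 0 \<le> v2" and ne: "p \<noteq> (a, ?m, vt, ?V)"
  obtain m1 m2 v1 v2 where p: "p = (m1, m2, v1, v2)"
    by (cases p)
  have opt: "kl_div (true_history a b vt c) (history_law (Psi a ?m vt ?V g) c) =
      ereal (?w * ln (?V / vt) / 2)"
    using vt V by (simp add: kl_div_history_fitted)
  have "kl_div (true_history a b vt c) (history_law (Psi a ?m vt ?V g) c) <
      kl_div (true_history a b vt c) (history_law (Psi m1 m2 v1 v2 g) c)"
  proof (cases "v1 = 0 \<or> v2 = 0")
    case True
    then show ?thesis
      using nonneg opt vt by (simp add: p kl_div_history_degenerate)
  next
    case False
    then have v: "0 < v1" "0 < v2"
      using nonneg by (auto simp: p)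
    let ?A1 = "vt + (a - m1)\<^sup>2" and ?A2 = "?V + (?m - m2 + g * (a - m1))\<^sup>2"
    let ?k1 = "ln (v1 / vt) - 1 + ?A1 / v1" and ?k2 = "ln (v2 / vt) - 1 + ?A2 / v2"
    have k1: "0 \<le> ?k1" "?k1 = 0 \<Longrightarrow> v1 = vt \<and> ?A1 = vt"
      using ln_add_ratio_ge[of vt v1 vt ?A1] vt v by simp_all
    have k2: "ln (?V / vt) \<le> ?k2" "?k2 = ln (?V / vt) \<Longrightarrow> v2 = ?V \<and> ?A2 = ?V"
      using ln_add_ratio_ge[of vt v2 ?V ?A2] vt v V by simp_all
    \<comment> \<open>Equality in the first term fixes \<open>m1\<close> and \<open>v1\<close>; with
      \<open>m1 = a\<close>, equality in the second fixes \<open>m2\<close> and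
      \<open>v2\<close>.\<close>
    have "?k1 \<noteq> 0 \<or> ?k2 \<noteq> ln (?V / vt)"
      using k1(2) k2(2) ne by (auto simp: p)
    then have "0 < ?k1 \<or> ln (?V / vt) < ?k2"
      using k1(1) k2(1) by linarith
    moreover have "?w * ln (?V / vt) \<le> ?w * ?k2"
      using k2(1) by (intro mult_left_mono less_imp_le[OF Phi_pos])
    moreover have "?w * ln (?V / vt) < ?w * ?k2" if "ln (?V / vt) < ?k2"
      using that by (intro mult_strict_left_mono Phi_pos)
    ultimately have "?w * ln (?V / vt) / 2 < ?k1 / 2 + ?w * ?k2 / 2"
      using k1(1) by argo
    then show ?thesis
      unfolding opt kl_div_history_fitted[OF vt v] by simp
  qed
  then show "(case (a, ?m, vt, ?V) of (m1, m2, v1, v2) \<Rightarrow>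
        kl_div (true_history a b vt c) (history_law (Psi m1 m2 v1 v2 g) c)) <
      (case p of (m1, m2, v1, v2) \<Rightarrow>
        kl_div (true_history a b vt c) (history_law (Psi m1 m2 v1 v2 g) c))"
    by (simp add: p)
qed

text \<open>With the variances held at \<open>vt\<close>, the excess over the candidate is half a
  weighted sum of two squared biases, and both vanish only at the candidate.\<close>

lemma min_known_var_iff:
  assumes vt: "0 < vt"
  shows "min_known_var a b vt g c p \<longleftrightarrow> p = (a, fitted_mean a b vt g c)"
  unfolding min_known_var_def
proof (rule is_arg_min_eq_iff)
  let ?V = "fitted_var a vt g c" and ?m = "fitted_mean a b vt g c"
  let ?w = "\<Phi> ((c - a) / sqrt vt)"
  fix p assume ne: "p \<noteq> (a, ?m)"
  obtain m1 m2 where p: "p = (m1, m2)"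
    by (cases p)
  let ?d1 = "(a - m1)\<^sup>2" and ?d2 = "(?m - m2 + g * (a - m1))\<^sup>2"
  have "0 < ?d1 \<or> 0 < ?d2"
    using ne by (auto simp: p)
  have "0 < ?d1 / vt + ?w * ?d2 / vt"
  proof -
    have "0 \<le> ?d1 / vt" "0 \<le> ?w * ?d2 / vt"
      using vt by (simp_all add: less_imp_le[OF Phi_pos])
    moreover have "0 < ?d1 \<Longrightarrow> 0 < ?d1 / vt" "0 < ?d2 \<Longrightarrow> 0 < ?w * ?d2 / vt"
      using vt by (auto intro!: divide_pos_pos mult_pos_pos)
    ultimately show ?thesis
      using \<open>0 < ?d1 \<or> 0 < ?d2\<close> by linarith
  qed
  then have "((ln (vt / vt) - 1 + (vt + (a - a)\<^sup>2) / vt) / 2 +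
      ?w * (ln (vt / vt) - 1 + (?V + (?m - ?m + g * (a - a))\<^sup>2) / vt) / 2) <
      ((ln (vt / vt) - 1 + (vt + ?d1) / vt) / 2 +
      ?w * (ln (vt / vt) - 1 + (?V + ?d2) / vt) / 2)"
    by (simp add: add_divide_distrib diff_divide_distrib ring_distribs)
  then show "(case (a, ?m) of (m1, m2) \<Rightarrow>
        kl_div (true_history a b vt c) (history_law (Psi m1 m2 vt vt g) c)) <
      (case p of (m1, m2) \<Rightarrow>
        kl_div (true_history a b vt c) (history_law (Psi m1 m2 vt vt g) c))"
    using vt by (simp only: p kl_div_history_fitted prod.case less_ereal.simps)
qed simp

section \<open>Optimal cutoffs\<close>

text \<open>The gain from stopping over continuing, when the first draw exceeds the mean of the second,
  normally distributed one by \<open>d\<close> and \<open>\<sigma>\<close> is the standard deviation of the latter.\<close>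

definition stopping_gain :: "real \<Rightarrow> real \<Rightarrow> real \<Rightarrow> real \<Rightarrow> real" where
  "stopping_gain q \<kappa> \<sigma> d = d - q * \<sigma> * \<Phi>2 (d / \<sigma>) + \<kappa>"

lemma stopping_gain_has_derivative:
  assumes "0 < \<sigma>"
  shows "(stopping_gain q \<kappa> \<sigma> has_real_derivative 1 - q * \<Phi> (x / \<sigma>)) (at x)"
  unfolding stopping_gain_def[abs_def] using assms
  by (auto intro!: derivative_eq_intros DERIV_chain2[where f = \<Phi>2] Phi2_has_derivative)

text \<open>The derivative \<open>1 - q * \<Phi> (x / \<sigma>)\<close> is at least
  \<open>1 - q\<close>, which is positive for imperfect recall.\<close>

lemma stopping_gain_strict_mono:
  assumes "0 < \<sigma>" "0 < q" "q < 1" "d < d'"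
  shows "stopping_gain q \<kappa> \<sigma> d < stopping_gain q \<kappa> \<sigma> d'"
proof (rule DERIV_pos_imp_increasing[OF \<open>d < d'\<close>])
  fix x
  note stopping_gain_has_derivative[OF assms(1), of q \<kappa> x]
  moreover have "q * \<Phi> (x / \<sigma>) \<le> q * 1"
    using assms std_normal.cdf_bounded_prob[of "x / \<sigma>"]
    by (intro mult_left_mono) (auto simp: \<Phi>_def)
  then have "q * \<Phi> (x / \<sigma>) < 1"
    using assms by linarith
  ultimately show "\<exists>D. (stopping_gain q \<kappa> \<sigma> has_real_derivative D) (at x) \<and> 0 < D"
    using assms by (intro exI[of _ "1 - q * \<Phi> (x / \<sigma>)"]) auto
qed

text \<open>In the derivative with respect to the standard deviation the \<open>\<Phi>\<close> terms
  cancel, leaving \<open>- q * \<phi> (d / \<sigma>)\<close>: recall acts as an option whose value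
  rises with volatility.\<close>

lemma stopping_gain_strict_antimono:
  assumes "0 < \<sigma>" "\<sigma> < \<sigma>'" "0 < q"
  shows "stopping_gain q \<kappa> \<sigma>' d < stopping_gain q \<kappa> \<sigma> d"
proof (rule DERIV_neg_imp_decreasing[OF \<open>\<sigma> < \<sigma>'\<close>])
  fix x assume "\<sigma> \<le> x"
  then have x: "0 < x"
    using assms by simp
  have d: "((\<lambda>\<sigma>. d / \<sigma>) has_real_derivative - d / (x * x)) (at x)"
    using x by (auto intro!: derivative_eq_intros)
  have "((\<lambda>\<sigma>. \<Phi>2 (d / \<sigma>)) has_real_derivative \<Phi> (d / x) * (- d / (x * x))) (at x)"
    by (rule DERIV_chain2[OF Phi2_has_derivative d])
  then have "((\<lambda>\<sigma>. stopping_gain q \<kappa> \<sigma> d) has_real_derivative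
      - (q * \<Phi>2 (d / x) + \<Phi> (d / x) * (- d / (x * x)) * (q * x))) (at x)"
    unfolding stopping_gain_def by (auto intro!: derivative_eq_intros)
  also have "- (q * \<Phi>2 (d / x) + \<Phi> (d / x) * (- d / (x * x)) * (q * x)) = - (q * \<phi> (d / x))"
    using x by (simp add: \<Phi>2_def field_simps)
  finally show "\<exists>D. ((\<lambda>\<sigma>. stopping_gain q \<kappa> \<sigma> d) has_real_derivative D) (at x) \<and> D < 0"
    using assms by (intro exI[of _ "- (q * \<phi> (d / x))"]) auto
qed

text \<open>Continuing pays the second draw y, plus q times \<open>max 0 (x - y)\<close>, minus the
  cost. The middle term is a put option with strike x, valued by
  \<open>Phi2_integral\<close>.\<close>

lemma continuation_value:
  assumes \<sigma>: "0 < \<sigma>"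
  shows "has_bochner_integral std_normal (\<lambda>w. u2 q \<kappa> x (m + \<sigma> * w)) (x - stopping_gain q \<kappa> \<sigma> (x - m))"
proof -
  let ?d = "x - m"
  have one: "has_bochner_integral std_normal (\<lambda>_. k :: real) k" for k
    using std_normal.prob_space by (simp add: has_bochner_integral_iff)
  have "has_bochner_integral std_normal
      (\<lambda>w. m - \<kappa> + \<sigma> * w + q * \<sigma> * max 0 (?d / \<sigma> - w)) (m - \<kappa> + \<sigma> * 0 + q * \<sigma> * \<Phi>2 (?d / \<sigma>))"
    by (intro has_bochner_integral_add has_bochner_integral_mult_right one
        std_normal_moment_1 Phi2_integral)
  also have "(\<lambda>w. m - \<kappa> + \<sigma> * w + q * \<sigma> * max 0 (?d / \<sigma> - w)) = (\<lambda>w. u2 q \<kappa> x (m + \<sigma> * w))"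
  proof
    fix w
    have "\<sigma> * max 0 (?d / \<sigma> - w) = max 0 (x - (m + \<sigma> * w))"
      using \<sigma> by (simp add: max_def field_simps)
    also have "\<dots> = max x (m + \<sigma> * w) - (m + \<sigma> * w)"
      by (simp add: max_def)
    finally have eq: "\<sigma> * max 0 (?d / \<sigma> - w) = max x (m + \<sigma> * w) - (m + \<sigma> * w)" .
    show "m - \<kappa> + \<sigma> * w + q * \<sigma> * max 0 (?d / \<sigma> - w) = u2 q \<kappa> x (m + \<sigma> * w)"
      unfolding u2_def mult.assoc eq by (simp add: algebra_simps)
  qed
  finally show ?thesis
    by (simp add: stopping_gain_def algebra_simps)
qed

text \<open>Integrating out the second draw by Fubini replaces the random continuation payoff by its
  conditional value, so strategies can be compared pointwise in the first draw.\<close>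

lemma expected_payoff_Psi:
  assumes v: "0 < v1" "0 < v2" and q: "0 \<le> q" "q \<le> 1" and S [measurable]: "S \<in> sets borel"
  shows "has_bochner_integral std_normal
    (\<lambda>z. let x = m1 + sqrt v1 * z in
      if x \<in> S then x else x - stopping_gain q \<kappa> (sqrt v2) (x - m2 + g * (x - m1)))
    (expected_payoff q \<kappa> (Psi m1 m2 v1 v2 g) S)"
    (is "has_bochner_integral _ ?f _")
proof -
  let ?N = "std_normal \<Otimes>\<^sub>M std_normal"
  let ?X = "\<lambda>z. m1 + sqrt v1 * z" and ?Y = "\<lambda>z w. m2 - g * (sqrt v1 * z) + sqrt v2 * w"
  define H where "H = (\<lambda>(z, w). if ?X z \<in> S then u1 (?X z) else u2 q \<kappa> (?X z) (?Y z w))"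
  have [measurable]: "H \<in> borel_measurable ?N"
    unfolding H_def u1_def u2_def by measurable
  have one: "has_bochner_integral std_normal (\<lambda>_. 1 :: real) 1"
    using std_normal.prob_space by (simp add: has_bochner_integral_iff)
  note product = std_normal_pair.has_bochner_integral_product
  have "integrable ?N fst" "integrable ?N snd"
    using product[OF std_normal_moment_1 one] product[OF one std_normal_moment_1]
    by (auto simp: has_bochner_integral_iff split_beta')
  then have "integrable ?N (\<lambda>p. 2 * \<bar>m1 + sqrt v1 * fst p\<bar> +
      2 * \<bar>m2 - g * (sqrt v1 * fst p) + sqrt v2 * snd p\<bar> + \<bar>\<kappa>\<bar>)"
    by (intro Bochner_Integration.integrable_add Bochner_Integration.integrable_diff
        integrable_mult_right integrable_abs) simp_all
  then have int: "integrable ?N H"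
  proof (rule Bochner_Integration.integrable_bound)
    \<comment> \<open>A linear bound uniform in the strategy suffices, because both draws are
      integrable.\<close>
    have bound: "\<bar>if x \<in> S then u1 x else u2 q \<kappa> x y\<bar> \<le> 2 * \<bar>x\<bar> + 2 * \<bar>y\<bar> + \<bar>\<kappa>\<bar>" for x y
    proof -
      have "\<bar>q * max x y\<bar> \<le> \<bar>x\<bar> + \<bar>y\<bar>"
        using mult_mono[of q 1 "\<bar>max x y\<bar>" "\<bar>x\<bar> + \<bar>y\<bar>"] q by (auto simp: abs_mult max_def)
      moreover have "\<bar>(1 - q) * y\<bar> \<le> \<bar>y\<bar>"
        using mult_mono[of "1 - q" 1 "\<bar>y\<bar>" "\<bar>y\<bar>"] q by (simp add: abs_mult)
      ultimately show ?thesis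
        unfolding u1_def u2_def by (simp split: if_split) linarith
    qed
    show "AE p in ?N. norm (H p) \<le> norm (2 * \<bar>m1 + sqrt v1 * fst p\<bar> +
      2 * \<bar>m2 - g * (sqrt v1 * fst p) + sqrt v2 * snd p\<bar> + \<bar>\<kappa>\<bar>)"
      using bound by (intro AE_I2) (simp add: H_def split_beta')
  qed simp
  have inner: "(\<integral>w. H (z, w) \<partial>std_normal) = ?f z" for z
  proof (cases "?X z \<in> S")
    case True
    then show ?thesis
      using has_bochner_integral_mult_right[OF one, of "?X z"]
      by (simp add: H_def u1_def Let_def has_bochner_integral_iff)
  next
    case False
    have "has_bochner_integral std_normal (\<lambda>w. H (z, w))
        (?X z - stopping_gain q \<kappa> (sqrt v2) (?X z - (m2 - g * (sqrt v1 * z))))"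
      using False continuation_value[of "sqrt v2" q \<kappa> "?X z" "m2 - g * (sqrt v1 * z)"] v
      by (simp add: H_def)
    then show ?thesis
      using False by (simp add: has_bochner_integral_iff Let_def algebra_simps)
  qed
  have "expected_payoff q \<kappa> (Psi m1 m2 v1 v2 g) S = integral\<^sup>L ?N H"
    unfolding expected_payoff_def Psi_eq_distr[OF less_imp_le[OF v(1)] less_imp_le[OF v(2)]]
      H_def u1_def u2_def
    by (subst integral_distr) (simp_all add: split_beta' cong: if_cong)
  then show ?thesis
    using std_normal_pair.integrable_fst'[OF int] std_normal_pair.integral_fst'[OF int]
    by (simp add: inner has_bochner_integral_iff)
qed

text \<open>Stopping exactly where the gain is nonnegative is best pointwise, so an optimal cutoff
  rule must yield the same conditional payoff almost everywhere. A nonzero gain at the cutoff would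
  keep its sign nearby and make the rule wrong on an interval at one side.\<close>

lemma optimal_cutoff_indifferent:
  assumes v: "0 < v1" "0 < v2" and q: "0 \<le> q" "q \<le> 1"
    and opt: "optimal_strategy q \<kappa> (Psi m1 m2 v1 v2 g) {c..}"
  shows "stopping_gain q \<kappa> (sqrt v2) (c - m2 + g * (c - m1)) = 0"
proof (rule ccontr)
  assume ne: "stopping_gain q \<kappa> (sqrt v2) (c - m2 + g * (c - m1)) \<noteq> 0"
  define D where "D x = stopping_gain q \<kappa> (sqrt v2) (x - m2 + g * (x - m1))" for x
  define X where "X z = m1 + sqrt v1 * z" for z
  define z0 where "z0 = (c - m1) / sqrt v1"
  have D0: "D (X z0) \<noteq> 0"
    using ne v by (simp add: D_def X_def z0_def)
  have X_le: "c \<le> X z \<longleftrightarrow> z0 \<le> z" for z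
    using v by (simp add: X_def z0_def field_simps)
  have D_cont: "isCont D x" for x
    unfolding D_def
    by (rule isCont_o2[where f = "\<lambda>x. x - m2 + g * (x - m1)" and
          g = "stopping_gain q \<kappa> (sqrt v2)", OF _ DERIV_isCont[OF stopping_gain_has_derivative]])
      (use v in \<open>auto intro!: continuous_intros\<close>)
  have cont: "isCont (\<lambda>z. D (X z)) z" for z
    unfolding X_def by (rule isCont_o2[OF _ D_cont]) (intro continuous_intros)
  have [measurable]: "D \<in> borel_measurable borel"
    by (intro borel_measurable_continuous_onI continuous_at_imp_continuous_on) (simp add: D_cont)
  define S where "S = {x. 0 \<le> D x}"
  have [measurable]: "S \<in> sets borel"
    unfolding S_def by measurable
  define f where "f T z = (if X z \<in> T then X z else X z - D (X z))" for T z
  have f: "has_bochner_integral std_normal (f T) (expected_payoff q \<kappa> (Psi m1 m2 v1 v2 g) T)"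
    if "T \<in> sets borel" for T
    using expected_payoff_Psi[OF v q that] unfolding f_def[abs_def] X_def D_def Let_def .
  have diff: "has_bochner_integral std_normal (\<lambda>z. f S z - f {c..} z)
      (expected_payoff q \<kappa> (Psi m1 m2 v1 v2 g) S - expected_payoff q \<kappa> (Psi m1 m2 v1 v2 g) {c..})"
    by (intro has_bochner_integral_diff f) simp_all
  have nonneg: "0 \<le> f S z - f {c..} z" for z
    by (simp add: f_def S_def)
  have "\<not> expected_payoff q \<kappa> (Psi m1 m2 v1 v2 g) S > expected_payoff q \<kappa> (Psi m1 m2 v1 v2 g) {c..}"
    using opt \<open>S \<in> sets borel\<close> by (auto simp: optimal_strategy_def is_arg_max_def)
  moreover have "0 \<le> (\<integral>z. f S z - f {c..} z \<partial>std_normal)"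
    using nonneg by (intro Bochner_Integration.integral_nonneg) simp
  ultimately have "(\<integral>z. f S z - f {c..} z \<partial>std_normal) = 0"
    using diff by (simp add: has_bochner_integral_iff)
  then have "AE z in std_normal. f S z - f {c..} z = 0"
    using diff nonneg by (subst (asm) integral_nonneg_eq_0_iff_AE) (auto simp: has_bochner_integral_iff)
  \<comment> \<open>Positivity of the density turns a statement about the normal law into one about
    Lebesgue measure.\<close>
  then have AE: "AE z in lborel. f S z = f {c..} z"
    unfolding normal_law_std by (subst (asm) AE_density) (auto simp: ennreal_less_zero_iff)
  consider (pos) "0 < D (X z0)" | (neg) "D (X z0) < 0"
    using D0 by linarith
  then show False
  proof cases
    case pos
    then have "\<forall>\<^sub>F z in at z0. 0 < D (X z)"
      using cont[of z0] by (auto simp: isCont_def order_tendstoD)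
    then obtain d where d: "0 < d" "\<And>z. z \<noteq> z0 \<Longrightarrow> dist z z0 < d \<Longrightarrow> 0 < D (X z)"
      by (auto simp: eventually_at)
    \<comment> \<open>Just below the cutoff the rule continues although stopping is strictly
      better.\<close>
    have "f S z \<noteq> f {c..} z" if "z \<in> {z0 - d<..<z0}" for z
      using d(2)[of z] that X_le[of z] by (auto simp: f_def S_def dist_real_def)
    then have "AE z in lborel. z \<notin> {z0 - d<..<z0}"
      using AE by (auto elim!: eventually_mono)
    then show False
      using lborel_not_AE_notin_interval[of "z0 - d" z0] d(1) by simp
  next
    case neg
    then have "\<forall>\<^sub>F z in at z0. D (X z) < 0"
      using cont[of z0] by (auto simp: isCont_def order_tendstoD)
    then obtain d where d: "0 < d" "\<And>z. z \<noteq> z0 \<Longrightarrow> dist z z0 < d \<Longrightarrow> D (X z) < 0"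
      by (auto simp: eventually_at)
    \<comment> \<open>Just above the cutoff the rule stops although continuing is strictly
      better.\<close>
    have "f S z \<noteq> f {c..} z" if "z \<in> {z0<..<z0 + d}" for z
      using d(2)[of z] that X_le[of z] by (auto simp: f_def S_def dist_real_def)
    then have "AE z in lborel. z \<notin> {z0<..<z0 + d}"
      using AE by (auto elim!: eventually_mono)
    then show False
      using lborel_not_AE_notin_interval[of z0 "z0 + d"] d(1) by simp
  qed
qed

section \<open>Comparison of the two steady states\<close>

theorem proposition6:
  fixes mt1 mt2 vt \<kappa> q \<gamma> :: real
    and m1A m2A cA :: real
    and m1B m2B v1B v2B cB :: real
  assumes "0 < vt"
    and "0 < \<gamma>"
    and "0 < q" and "q < 1"
    and "steady_state_A mt1 mt2 vt \<kappa> q \<gamma> m1A m2A cA"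
    and "steady_state_B mt1 mt2 vt \<kappa> q \<gamma> m1B m2B v1B v2B cB"
  shows "m2B > m2A \<and> cB > cA \<and> sqrt v2B > sigma2_star mt1 mt2 vt \<gamma> cA"
proof -
  note vt = \<open>0 < vt\<close> and \<gamma> = \<open>0 < \<gamma>\<close> and q = \<open>0 < q\<close> \<open>q < 1\<close>
  define Z where "Z c = (c - mt1) / sqrt vt" for c
  have Z_mono: "Z c < Z c'" if "c < c'" for c c'
    using that vt by (simp add: Z_def divide_strict_right_mono)
  let ?m = "fitted_mean mt1 mt2 vt \<gamma>" and ?v = "fitted_var mt1 vt \<gamma>"
  have A: "m1A = mt1" "m2A = ?m cA" and optA: "optimal_strategy q \<kappa> (Psi m1A m2A vt vt \<gamma>) {cA..}"
    using assms(5) by (auto simp: steady_state_A_def min_known_var_iff[OF vt])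
  have B: "m1B = mt1" "m2B = ?m cB" "v1B = vt" "v2B = ?v cB"
    and optB: "optimal_strategy q \<kappa> (Psi m1B m2B v1B v2B \<gamma>) {cB..}"
    using assms(6) by (auto simp: steady_state_B_def min_unknown_var_iff[OF vt])
  have star: "sigma2_star mt1 mt2 vt \<gamma> cA = sqrt (?v cA)"
    by (simp add: sigma2_star_def min_unknown_var_iff[OF vt])
  have var_less: "vt < ?v c" for c
    using vt \<gamma> trunc_var_pos[of "Z c"] by (simp add: fitted_var_def Z_def)
  have var_mono: "?v c < ?v c'" if "c < c'" for c c'
    using trunc_var_strict_mono[OF Z_mono[OF that]] vt \<gamma> by (simp add: fitted_var_def Z_def)
  have mean_mono: "?m c < ?m c'" if "c < c'" for c c'
    using mills_strict_antimono[OF Z_mono[OF that]] vt \<gamma> by (simp add: fitted_mean_def Z_def)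
  define d where "d c = c - ?m c + \<gamma> * (c - mt1)" for c
  \<comment> \<open>The inferred second mean rises with c and by itself could lower d. Combined with
    the reversal term it leaves \<open>Z c + mills (Z c)\<close>, which increases.\<close>
  have d_eq: "d c = c - mt2 + \<gamma> * sqrt vt * (Z c + mills (Z c))" for c
  proof -
    have scale: "c - mt1 = sqrt vt * Z c"
      using vt by (simp add: Z_def)
    show ?thesis
      unfolding d_def fitted_mean_def Z_def[symmetric] scale by (simp add: algebra_simps)
  qed
  have d_mono: "d c < d c'" if "c < c'" for c c'
  proof -
    have "\<gamma> * sqrt vt * (Z c + mills (Z c)) < \<gamma> * sqrt vt * (Z c' + mills (Z c'))"
      using vt \<gamma> by (intro mult_strict_left_mono mean_excess_strict_mono Z_mono[OF that]) simp
    then show ?thesis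
      unfolding d_eq using that by linarith
  qed
  have gainA: "stopping_gain q \<kappa> (sqrt vt) (d cA) = 0"
    using optimal_cutoff_indifferent[OF vt vt _ _ optA] q by (simp add: A d_def)
  have vB: "0 < v1B" "0 < v2B"
    using vt var_less[of cB] by (auto simp: B)
  have gainB: "stopping_gain q \<kappa> (sqrt (?v cB)) (d cB) = 0"
    using optimal_cutoff_indifferent[OF vB _ _ optB] q by (simp add: B d_def)
  have "cA < cB"
  \<comment> \<open>If \<open>cB \<le> cA\<close>, the gain at \<open>d cB\<close> under the true
    variance is at most 0, and the larger inferred variance makes it negative, against the
    indifference of Society B.\<close>
  proof (rule ccontr)
    assume "\<not> cA < cB"
    then have "d cB \<le> d cA"
      using d_mono[of cB cA] by (cases "cA = cB") auto
    then have "stopping_gain q \<kappa> (sqrt vt) (d cB) \<le> stopping_gain q \<kappa> (sqrt vt) (d cA)"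
      using stopping_gain_strict_mono[of "sqrt vt" q "d cB" "d cA" \<kappa>] vt q
      by (cases "d cB = d cA") auto
    moreover have "stopping_gain q \<kappa> (sqrt (?v cB)) (d cB) < stopping_gain q \<kappa> (sqrt vt) (d cB)"
      using vt q var_less[of cB] by (intro stopping_gain_strict_antimono) auto
    ultimately show False
      using gainA gainB by simp
  qed
  then show ?thesis
    using mean_mono[of cA cB] var_mono[of cA cB] by (simp add: A(2) B(2,4) star)
qed

end
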